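(* Let $q\in(-1,1)$, let $W^{(q)}=\{W^{(q)}_t\}_{t\ge0}$ be the $q$-Brownian motion, let $s>0$ and $x\in\left(-2\sqrt{\frac{s}{1-q}},\,2\sqrt{\frac{s}{1-q}}\right)$. For $\epsilon>0$ put $$V^{(\epsilon,s)}_t:=\frac{W^{(q)}_{s+t\epsilon}-W^{(q)}_s}{\epsilon},\qquad t\ge0.$$ Then, under the law $\mathbb{P}(\cdot\mid W^{(q)}_s=x)$, as $\epsilon\downarrow0$, the finite-dimensional distributions of $\{V^{(\epsilon,s)}_t\}_{t\ge0}$ converge weakly to those of $$c_{q,s,x}\left\{\mathbb{Z}^{(1)}_t+\frac{x}{\sqrt{\frac{4s}{1-q}-x^2}}\cdot t\right\}_{t\ge0},\qquad c_{q,s,x}=\frac{1}{2s}\sqrt{\frac{4s}{1-q}-x^2},$$ where $\mathbb{Z}^{(1)}$ is the Cauchy process.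
   Context: The $q$-Brownian motion $W^{(q)}=\{W^{(q)}_t\}_{t\ge0}$, $q\in(-1,1)$, is the càdlàg Markov process starting from $0$, whose support at time $t$ is $[-2\sqrt{t/(1-q)},2\sqrt{t/(1-q)}]$, and whose transition probability density from $y_1$ at time $t_1$ to $y_2$ at time $t_2>t_1$ (with $y_i$ in the support at time $t_i$) is $$\kappa^{(q)}_{t_1,t_2}(y_1,y_2)=\frac{(1-q)^{3/2}(t_2-t_1)}{2\pi}\,\frac{\sqrt{4t_2-(1-q)y_2^2}}{\varphi^*_{q,0}(t_1,t_2,y_1,y_2)}\prod_{k=1}^\infty\frac{\psi^*_{q,k}(t_1,t_2,y_2)}{\varphi^*_{q,k}(t_1,t_2,y_1,y_2)},$$ where, for $k\ge1$, $$\psi^*_{q,k}(t_1,t_2,y_2)=(t_2-t_1q^k)(1-q^{k+1})\left[t_2(1+q^k)^2-(1-q)y_2^2q^k\right]$$ and, for $k\ge0$ (with $q^0=1$, also for $q=0$), $$\varphi^*_{q,k}(t_1,t_2,y_1,y_2)=(t_2-t_1q^{2k})^2-(1-q)q^k(t_2+t_1q^{2k})y_1y_2+(1-q)(t_1y_2^2+t_2y_1^2)q^{2k}.$$ $\mathbb{P}(\cdot\mid W^{(q)}_s=x)$ denotes the law of the Markov process $\{W^{(q)}_t\}_{t\ge s}$ started at $x$ at time $s$ with these transition densities. The Cauchy process $\mathbb{Z}^{(1)}=\{\mathbb{Z}^{(1)}_t\}_{t\ge0}$ is the symmetric $1$-stable Lévy process starting from $0$ with transition probability density $$f^{(1)}_{t_1,t_2}(y_1,y_2)=\frac1\pi\,\frac{t_2-t_1}{(y_2-y_1)^2+(t_2-t_1)^2},\quad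 0\le t_1<t_2<\infty,\ y_1,y_2\in\mathbb{R}.$$ *)

theory Defs
  imports "HOL-Probability.Probability"
begin

section \<open>Processes, finite-dimensional distributions, weak convergence\<close>

text \<open>Real-valued processes indexed by time are functions \<open>X :: real \<Rightarrow> 'a \<Rightarrow> real\<close>; only the times
  in \<open>[s, \<infinity>)\<close> matter, where \<open>s\<close> is the starting time.\<close>

definition cadlag_from :: "real \<Rightarrow> (real \<Rightarrow> real) \<Rightarrow> bool" where
  "cadlag_from s f \<longleftrightarrow>
     (\<forall>t\<ge>s. (f \<longlongrightarrow> f t) (at_right t)) \<and> (\<forall>t>s. \<exists>l. (f \<longlongrightarrow> l) (at_left t))"

definition natural_filtration ::
    "'a measure \<Rightarrow> real \<Rightarrow> (real \<Rightarrow> 'a \<Rightarrow> real) \<Rightarrow> real \<Rightarrow> 'a measure" where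
  "natural_filtration M s X t =
     sigma (space M) (\<Union>u\<in>{s..t}. {X u -` A \<inter> space M | A. A \<in> sets borel})"

text \<open>\<open>p t1 t2 y1 y2\<close> is the density of the transition from \<open>y1\<close> at time \<open>t1\<close> to \<open>y2\<close> at time
  \<open>t2\<close>; as a function of \<open>y2\<close> it is understood to vanish outside the support \<open>S t2\<close>.\<close>

definition markov_process_from ::
    "real \<Rightarrow> real \<Rightarrow> (real \<Rightarrow> real set) \<Rightarrow> (real \<Rightarrow> real \<Rightarrow> real \<Rightarrow> real \<Rightarrow> real)
      \<Rightarrow> 'a measure \<Rightarrow> (real \<Rightarrow> 'a \<Rightarrow> real) \<Rightarrow> bool" where
  "markov_process_from s x S p M X \<longleftrightarrow>
     prob_space M \<and>
     (\<forall>t\<ge>s. X t \<in> borel_measurable M) \<and>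
     (AE \<omega> in M. X s \<omega> = x) \<and>
     (\<forall>\<omega>\<in>space M. cadlag_from s (\<lambda>t. X t \<omega>)) \<and>
     (\<forall>t1\<ge>s. \<forall>t2>t1. \<forall>A\<in>sets borel. AE \<omega> in M.
        real_cond_exp M (natural_filtration M s X t1) (\<lambda>\<omega>'. indicator A (X t2 \<omega>')) \<omega>
          = (LINT y:A \<inter> S t2|lborel. p t1 t2 (X t1 \<omega>) y))"

definition fdd :: "'a measure \<Rightarrow> (real \<Rightarrow> 'a \<Rightarrow> real) \<Rightarrow> real ^ 'n \<Rightarrow> (real ^ 'n) measure" where
  "fdd M X t = distr M borel (\<lambda>\<omega>. \<chi> i. X (t $ i) \<omega>)"

text \<open>The library's \<open>weak_conv\<close> only covers sequences of measures on the real line.\<close>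

definition weakly_converges ::
    "('b \<Rightarrow> 'a::real_normed_vector measure) \<Rightarrow> 'a measure \<Rightarrow> 'b filter \<Rightarrow> bool" where
  "weakly_converges \<mu> \<nu> F \<longleftrightarrow>
     (\<forall>f::'a \<Rightarrow> real. continuous_on UNIV f \<and> bounded (range f) \<longrightarrow>
        ((\<lambda>e. integral\<^sup>L (\<mu> e) f) \<longlongrightarrow> integral\<^sup>L \<nu> f) F)"

section \<open>The q-Brownian motion\<close>

definition psi_star :: "real \<Rightarrow> nat \<Rightarrow> real \<Rightarrow> real \<Rightarrow> real \<Rightarrow> real" where
  "psi_star q k t1 t2 y2 =
     (t2 - t1 * q ^ k) * (1 - q ^ (k + 1)) * (t2 * (1 + q ^ k)\<^sup>2 - (1 - q) * y2\<^sup>2 * q ^ k)"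

definition phi_star :: "real \<Rightarrow> nat \<Rightarrow> real \<Rightarrow> real \<Rightarrow> real \<Rightarrow> real \<Rightarrow> real" where
  "phi_star q k t1 t2 y1 y2 =
     (t2 - t1 * q ^ (2 * k))\<^sup>2
     - (1 - q) * q ^ k * (t2 + t1 * q ^ (2 * k)) * y1 * y2
     + (1 - q) * (t1 * y2\<^sup>2 + t2 * y1\<^sup>2) * q ^ (2 * k)"

definition q_kernel :: "real \<Rightarrow> real \<Rightarrow> real \<Rightarrow> real \<Rightarrow> real \<Rightarrow> real" where
  "q_kernel q t1 t2 y1 y2 =
     ((1 - q) powr (3 / 2) * (t2 - t1)) / (2 * pi)
     * (sqrt (4 * t2 - (1 - q) * y2\<^sup>2) / phi_star q 0 t1 t2 y1 y2)
     * prodinf (\<lambda>k. psi_star q (Suc k) t1 t2 y2 / phi_star q (Suc k) t1 t2 y1 y2)"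

definition q_support :: "real \<Rightarrow> real \<Rightarrow> real set" where
  "q_support q t = {- 2 * sqrt (t / (1 - q)) .. 2 * sqrt (t / (1 - q))}"

text \<open>\<open>W\<close>, observed at times \<open>t \<ge> s\<close>, has the law of the q-Brownian motion conditioned to be at \<open>x\<close>
  at time \<open>s\<close>; for \<open>s = 0\<close>, \<open>x = 0\<close> it is the q-Brownian motion itself.\<close>

definition q_brownian_motion_from ::
    "real \<Rightarrow> real \<Rightarrow> real \<Rightarrow> 'a measure \<Rightarrow> (real \<Rightarrow> 'a \<Rightarrow> real) \<Rightarrow> bool" where
  "q_brownian_motion_from q s x M W \<longleftrightarrow>
     markov_process_from s x (q_support q) (q_kernel q) M W"

section \<open>The Cauchy process\<close>

definition levy_process :: "'a measure \<Rightarrow> (real \<Rightarrow> 'a \<Rightarrow> real) \<Rightarrow> bool" where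
  "levy_process M Z \<longleftrightarrow>
     prob_space M \<and>
     (\<forall>t\<ge>0. Z t \<in> borel_measurable M) \<and>
     (AE \<omega> in M. Z 0 \<omega> = 0) \<and>
     (\<forall>\<omega>\<in>space M. cadlag_from 0 (\<lambda>t. Z t \<omega>)) \<and>
     (\<forall>(n::nat) t. 0 \<le> t 0 \<and> mono_on {..n} t \<longrightarrow>
        prob_space.indep_vars M (\<lambda>_. borel) (\<lambda>i \<omega>. Z (t (Suc i)) \<omega> - Z (t i) \<omega>) {..<n}) \<and>
     (\<forall>s\<ge>0. \<forall>h\<ge>0. distr M borel (\<lambda>\<omega>. Z (s + h) \<omega> - Z s \<omega>) = distr M borel (\<lambda>\<omega>. Z h \<omega> - Z 0 \<omega>))"

definition cauchy_kernel :: "real \<Rightarrow> real \<Rightarrow> real \<Rightarrow> real \<Rightarrow> real" where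
  "cauchy_kernel t1 t2 y1 y2 = 1 / pi * ((t2 - t1) / ((y2 - y1)\<^sup>2 + (t2 - t1)\<^sup>2))"

text \<open>Symmetry and 1-stability are not listed separately: they are properties of the explicit
  transition density.\<close>

definition cauchy_process :: "'a measure \<Rightarrow> (real \<Rightarrow> 'a \<Rightarrow> real) \<Rightarrow> bool" where
  "cauchy_process M Z \<longleftrightarrow>
     levy_process M Z \<and> markov_process_from 0 0 (\<lambda>_. UNIV) cauchy_kernel M Z"

section \<open>The rescaled process\<close>

definition rescaled_increments ::
    "(real \<Rightarrow> 'a \<Rightarrow> real) \<Rightarrow> real \<Rightarrow> real \<Rightarrow> real \<Rightarrow> 'a \<Rightarrow> real" where
  "rescaled_increments W s \<epsilon> t \<omega> = (W (s + t * \<epsilon>) \<omega> - W s \<omega>) / \<epsilon>"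

definition tangent_scale :: "real \<Rightarrow> real \<Rightarrow> real \<Rightarrow> real" where
  "tangent_scale q s x = 1 / (2 * s) * sqrt (4 * s / (1 - q) - x\<^sup>2)"

end

theory Submission
  imports Defs
begin

text \<open>
  Put \<open>t1 = s + u\<epsilon>\<close>, \<open>t2 = s + v\<epsilon>\<close>, \<open>y1 = x + \<epsilon>y\<close>, \<open>y2 = x + \<epsilon>z\<close>. Besides the factor
  \<open>t2 - t1 = \<epsilon>(v - u)\<close>, only \<open>phi_star q 0\<close> degenerates in the transition density as \<open>\<epsilon> \<down> 0\<close>: it is \<open>\<epsilon>\<^sup>2\<close> times a
  polynomial that converges to a quadratic form in \<open>(z - y, v - u)\<close>, and completing the square
  there gives the drift \<open>x / (2 s)\<close> and the scale \<open>tangent_scale q s x\<close>. The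
  infinite product is continuous up to the diagonal \<open>t1 = t2\<close>, where its factors reduce to
  \<open>(1 - q^(k+1)) / (1 - q^k)\<close> and telescope to \<open>1 / (1 - q)\<close>. Hence \<open>\<epsilon>\<close> times the transition density
  converges pointwise to the density of a scaled Cauchy process with drift
  (\<open>q_kernel_rescaled_tendsto\<close>).

  Pointwise convergence of transition densities is enough. By the Markov property the values of the
  rescaled process at finitely many increasing positive times have the product of its rescaled
  transition densities as joint Lebesgue density (\<open>distr_eq_joint_density\<close>), and the same
  holds for the limit process. These products converge pointwise, and each of them has integral \<open>1\<close>,
  being the density of a probability law; so by Scheffe's lemma they converge in \<open>L\<^sup>1\<close>, and
  the integrals of every bounded test function converge. That \<open>q_kernel\<close> integrates to \<open>1\<close>
  is itself a consequence of the Markov property, with the whole line as target set.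

  Times that are zero, repeated or unordered reduce to this case, because the vector of values at
  such times is a continuous image of the vector of values at the distinct positive ones.
\<close>

section \<open>The infinite product in the transition density\<close>

text \<open>The Weierstrass M-test, applied to the series of logarithms: eventually all factors are within \<open>1/2\<close>
  of \<open>1\<close>, and there \<open>\<bar>ln f\<bar> \<le> 2 * \<bar>f - 1\<bar>\<close>. The product is the exponential of the sum, which also makes
  it positive.\<close>

lemma continuous_on_prodinf_real:
  fixes f :: "nat \<Rightarrow> 'a::topological_space \<Rightarrow> real"
  assumes cont: "\<And>k. continuous_on K (f k)"
    and pos: "\<And>k x. x \<in> K \<Longrightarrow> f k x > 0"
    and bound: "\<And>k x. x \<in> K \<Longrightarrow> \<bar>f k x - 1\<bar> \<le> M k"
    and M: "summable M"
  shows "continuous_on K (\<lambda>x. prodinf (\<lambda>k. f k x))"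
    and "\<And>x. x \<in> K \<Longrightarrow> prodinf (\<lambda>k. f k x) > 0"
proof -
  have "eventually (\<lambda>k. M k < 1/2) sequentially"
    using order_tendstoD(2)[OF summable_LIMSEQ_zero[OF M], of "1/2"] by simp
  then have ev: "\<forall>\<^sub>F k in sequentially. \<forall>x\<in>K. norm (ln (f k x)) \<le> 2 * M k"
  proof eventually_elim
    case (elim k)
    show ?case
    proof
      fix x assume x: "x \<in> K"
      have "\<bar>ln (1 + (f k x - 1)) - (f k x - 1)\<bar> \<le> 2 * (f k x - 1)\<^sup>2"
        using bound[OF x, of k] elim by (intro abs_ln_one_plus_x_minus_x_bound) auto
      also have "\<dots> = 2 * \<bar>f k x - 1\<bar> * \<bar>f k x - 1\<bar>"
        by (simp add: power2_eq_square abs_mult_self_eq mult.assoc)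
      also have "\<dots> \<le> 2 * (1/2) * \<bar>f k x - 1\<bar>"
        using bound[OF x, of k] elim by (intro mult_right_mono) auto
      finally show "norm (ln (f k x)) \<le> 2 * M k"
        using bound[OF x, of k] by simp
    qed
  qed
  have ul: "uniform_limit K (\<lambda>n x. \<Sum>i<n. ln (f i x)) (\<lambda>x. \<Sum>i. ln (f i x)) sequentially"
    by (rule Weierstrass_m_test_ev[OF ev]) (use M in auto)
  have cs: "continuous_on K (\<lambda>x. \<Sum>i. ln (f i x))"
  proof (rule uniform_limit_theorem[OF _ ul])
    show "\<forall>\<^sub>F n in sequentially. continuous_on K (\<lambda>x. \<Sum>i<n. ln (f i x))"
      by (intro always_eventually allI continuous_intros cont) (use pos in \<open>force simp: less_le\<close>)
  qed auto
  have eq: "prodinf (\<lambda>k. f k x) = exp (\<Sum>i. ln (f i x))" if x: "x \<in> K" for x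
  proof -
    have "summable (\<lambda>k. ln (f k x))"
      by (rule summable_comparison_test_ev[OF _ summable_mult[OF M, of 2]])
         (use ev x in \<open>auto elim: eventually_mono\<close>)
    then have "prodinf (\<lambda>k. exp (ln (f k x))) = exp (\<Sum>i. ln (f i x))"
      by (rule prodinf_exp)
    then show ?thesis using pos[OF x] by simp
  qed
  show "continuous_on K (\<lambda>x. prodinf (\<lambda>k. f k x))"
    using continuous_on_exp[OF cs] eq by (simp cong: continuous_on_cong)
  show "\<And>x. x \<in> K \<Longrightarrow> prodinf (\<lambda>k. f k x) > 0" by (simp add: eq)
qed

lemma mem_q_support_iff:
  assumes "q < 1"
  shows "y \<in> q_support q t \<longleftrightarrow> (1 - q) * y\<^sup>2 \<le> 4 * t"
proof -
  have "y \<in> q_support q t \<longleftrightarrow> \<bar>y\<bar> \<le> sqrt (4 * t / (1 - q))"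
    unfolding q_support_def by (auto simp: real_sqrt_mult real_sqrt_divide)
  also have "\<dots> \<longleftrightarrow> sqrt (y\<^sup>2) \<le> sqrt (4 * t / (1 - q))" by simp
  also have "\<dots> \<longleftrightarrow> y\<^sup>2 \<le> 4 * t / (1 - q)" by (rule real_sqrt_le_iff)
  also have "\<dots> \<longleftrightarrow> (1 - q) * y\<^sup>2 \<le> 4 * t" using assms by (simp add: field_simps)
  finally show ?thesis .
qed

lemma abs_mult_le_of_support:
  fixes q t1 t2 y1 y2 :: real
  assumes "q < 1" "(1 - q) * y1\<^sup>2 \<le> 4 * t1" "(1 - q) * y2\<^sup>2 \<le> 4 * t2"
  shows "(1 - q) * \<bar>y1 * y2\<bar> \<le> 4 * (sqrt t1 * sqrt t2)"
proof -
  have "((1 - q) * \<bar>y1 * y2\<bar>)\<^sup>2 = ((1 - q) * y1\<^sup>2) * ((1 - q) * y2\<^sup>2)"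
    by (simp add: power_mult_distrib power2_eq_square)
  also have "\<dots> \<le> (4 * t1) * (4 * t2)"
  proof (rule mult_mono[OF assms(2,3)])
    have "0 \<le> (1 - q) * y1\<^sup>2" using assms(1) by simp
    then show "0 \<le> 4 * t1" using assms(2) by linarith
  qed (use assms(1) in simp)
  finally have "((1 - q) * \<bar>y1 * y2\<bar>)\<^sup>2 \<le> 16 * (t1 * t2)" by simp
  then have "(1 - q) * \<bar>y1 * y2\<bar> \<le> sqrt (16 * (t1 * t2))" by (rule real_le_rsqrt)
  then show ?thesis by (simp add: real_sqrt_mult)
qed

text \<open>With \<open>y1 = 2 sqrt (t1 / (1 - q)) cos \<alpha>\<close>, \<open>y2 = 2 sqrt (t2 / (1 - q)) cos \<beta>\<close> and
  \<open>\<rho> = sqrt (t1 / t2) * q ^ k\<close>, the number \<open>phi_star q k t1 t2 y1 y2 / t2\<^sup>2\<close> is the squared modulus of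
  \<open>(1 - \<rho> exp (\<i> (\<alpha> + \<beta>))) * (1 - \<rho> exp (\<i> (\<alpha> - \<beta>)))\<close>, hence at least \<open>(1 - \<bar>\<rho>\<bar>) ^ 4\<close>. The proof is an elementary
  version: the arithmetic-geometric mean inequality replaces the two squares by the product
  \<open>y1 * y2\<close>, after which the bound is affine in \<open>\<bar>y1 * y2\<bar>\<close> and smallest at the largest value that
  the supports allow.\<close>

lemma phi_star_ge:
  assumes q: "-1 < q" "q < 1" and t: "0 \<le> t1" "t1 \<le> t2"
    and y: "(1 - q) * y1\<^sup>2 \<le> 4 * t1" "(1 - q) * y2\<^sup>2 \<le> 4 * t2"
  shows "(sqrt t2 - sqrt t1 * \<bar>q\<bar> ^ k) ^ 4 \<le> phi_star q k t1 t2 y1 y2"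
proof -
  define a b r Q where "a = sqrt t1" and "b = sqrt t2" and "r = \<bar>q\<bar> ^ k" and "Q = q ^ k"
  have ab: "0 \<le> a" "a \<le> b" "t1 = a\<^sup>2" "t2 = b\<^sup>2" using t by (auto simp: a_def b_def)
  have r: "0 \<le> r" "r \<le> 1" "r = \<bar>Q\<bar>" "Q\<^sup>2 = r\<^sup>2" "q ^ (2 * k) = r\<^sup>2"
  proof -
    show "0 \<le> r" "r \<le> 1" using q by (auto simp: r_def intro!: power_le_one)
    show "r = \<bar>Q\<bar>" by (simp add: r_def Q_def power_abs)
    then show "Q\<^sup>2 = r\<^sup>2" by simp
    then show "q ^ (2 * k) = r\<^sup>2" unfolding Q_def power_even_eq .
  qed
  define u where "u = (1 - q) * \<bar>y1 * y2\<bar>"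
  have u: "0 \<le> u" "u \<le> 4 * (a * b)"
    using abs_mult_le_of_support[OF q(2) y] q by (auto simp: u_def a_def b_def)
  \<comment> \<open>the arithmetic-geometric mean inequality for the two squares\<close>
  have 1: "2 * a * b * u \<le> (1 - q) * (t1 * y2\<^sup>2 + t2 * y1\<^sup>2)"
  proof -
    have "0 \<le> (1 - q) * (a * \<bar>y2\<bar> - b * \<bar>y1\<bar>)\<^sup>2" using q by simp
    also have "\<dots> = (1 - q) * (t1 * y2\<^sup>2 + t2 * y1\<^sup>2) - 2 * a * b * u"
    proof -
      define m1 m2 where "m1 = \<bar>y1\<bar>" and "m2 = \<bar>y2\<bar>"
      have "y1\<^sup>2 = m1\<^sup>2" "y2\<^sup>2 = m2\<^sup>2" by (simp_all add: m1_def m2_def)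
      then show ?thesis unfolding ab(3,4) u_def abs_mult m1_def[symmetric] m2_def[symmetric]
        by (simp add: power2_eq_square algebra_simps)
    qed
    finally show ?thesis by simp
  qed
  have 2: "(1 - q) * Q * (t2 + t1 * r\<^sup>2) * y1 * y2 \<le> r * (b\<^sup>2 + a\<^sup>2 * r\<^sup>2) * u"
  proof -
    have "(1 - q) * Q * (t2 + t1 * r\<^sup>2) * y1 * y2 = (Q * (y1 * y2)) * ((1 - q) * (b\<^sup>2 + a\<^sup>2 * r\<^sup>2))"
      by (simp add: ab algebra_simps)
    also have "\<dots> \<le> (r * \<bar>y1 * y2\<bar>) * ((1 - q) * (b\<^sup>2 + a\<^sup>2 * r\<^sup>2))"
    proof (rule mult_right_mono)
      show "Q * (y1 * y2) \<le> r * \<bar>y1 * y2\<bar>"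
        using abs_ge_self[of "Q * (y1 * y2)"] by (simp add: r(3) abs_mult)
    qed (use q in simp)
    finally show ?thesis by (simp add: u_def algebra_simps)
  qed
  have 3: "r\<^sup>2 * (2 * a * b * u) \<le> r\<^sup>2 * ((1 - q) * (t1 * y2\<^sup>2 + t2 * y1\<^sup>2))"
    by (intro mult_left_mono 1) simp
  have 4: "r * (b - a * r)\<^sup>2 * u \<le> r * (b - a * r)\<^sup>2 * (4 * (a * b))"
    using r u by (intro mult_left_mono) auto
  have "(b - a * r) ^ 4 = (b\<^sup>2 - a\<^sup>2 * r\<^sup>2)\<^sup>2 - r * (b - a * r)\<^sup>2 * (4 * (a * b))"
    by (simp add: power2_eq_square power4_eq_xxxx algebra_simps)
  also have "\<dots> \<le> (b\<^sup>2 - a\<^sup>2 * r\<^sup>2)\<^sup>2 - r * (b - a * r)\<^sup>2 * u" using 4 by simp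
  also have "\<dots> = (b\<^sup>2 - a\<^sup>2 * r\<^sup>2)\<^sup>2 - r * (b\<^sup>2 + a\<^sup>2 * r\<^sup>2) * u + r\<^sup>2 * (2 * a * b * u)"
    by (simp add: power2_eq_square algebra_simps)
  also have "\<dots> \<le> (t2 - t1 * r\<^sup>2)\<^sup>2 - (1 - q) * Q * (t2 + t1 * r\<^sup>2) * y1 * y2
       + (1 - q) * (t1 * y2\<^sup>2 + t2 * y1\<^sup>2) * r\<^sup>2"
  proof -
    have "r\<^sup>2 * ((1 - q) * (t1 * y2\<^sup>2 + t2 * y1\<^sup>2)) = (1 - q) * (t1 * y2\<^sup>2 + t2 * y1\<^sup>2) * r\<^sup>2"
      by (simp only: mult.commute)
    with 2 3 show ?thesis unfolding ab(3,4) by linarith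
  qed
  also have "\<dots> = phi_star q k t1 t2 y1 y2"
    unfolding phi_star_def r(5) Q_def ..
  finally show ?thesis by (simp add: a_def b_def r_def)
qed

text \<open>All three factors of \<open>psi_star\<close> are positive because \<open>\<bar>q ^ Suc k\<bar> < 1\<close>; on the
  support the last one is at least \<open>t2 * (1 - \<bar>q ^ Suc k\<bar>)\<^sup>2\<close>.\<close>

lemma psi_star_Suc_pos:
  assumes q: "-1 < q" "q < 1" and t: "0 \<le> t1" "t1 \<le> t2" "0 < t2"
    and y2: "(1 - q) * y2\<^sup>2 \<le> 4 * t2"
  shows "0 < psi_star q (Suc k) t1 t2 y2"
proof -
  define Q where "Q = q ^ Suc k"
  have aq: "\<bar>q ^ Suc n\<bar> < 1" for n
    using q power_Suc_less_one[of "\<bar>q\<bar>" n] 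
    by (cases "q = 0") (auto simp: power_abs simp del: power_Suc intro!: power_less_one_iff[THEN iffD2])
  have Q: "\<bar>Q\<bar> < 1" unfolding Q_def by (rule aq)
  have 1: "0 < t2 - t1 * Q"
  proof -
    have "t1 * Q \<le> t1 * \<bar>Q\<bar>" using t by (intro mult_left_mono) auto
    also have "\<dots> \<le> t2 * \<bar>Q\<bar>" using t by (intro mult_right_mono) auto
    also have "\<dots> < t2" using t Q by simp
    finally show ?thesis by simp
  qed
  have 2: "0 < 1 - q ^ (Suc k + 1)" using aq[of "Suc k"] by (simp add: abs_less_iff)
  have 3: "0 < t2 * (1 + Q)\<^sup>2 - (1 - q) * y2\<^sup>2 * Q"
  proof -
    have "(1 - q) * y2\<^sup>2 * Q \<le> (1 - q) * y2\<^sup>2 * max Q 0"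
      using q by (intro mult_left_mono) auto
    also have "\<dots> \<le> 4 * t2 * max Q 0" using y2 by (intro mult_right_mono) auto
    also have "\<dots> < t2 * (1 + Q)\<^sup>2"
    proof -
      have "4 * max Q 0 < (1 + Q)\<^sup>2"
      proof (cases "Q \<ge> 0")
        case True
        have "0 < (1 - Q)\<^sup>2" using Q by simp
        with True show ?thesis by (simp add: power2_eq_square algebra_simps)
      qed (use Q in auto)
      then have "t2 * (4 * max Q 0) < t2 * (1 + Q)\<^sup>2" using t by (intro mult_strict_left_mono)
      then show ?thesis by (simp add: ac_simps)
    qed
    finally show ?thesis by simp
  qed
  show ?thesis unfolding psi_star_def using 1 2 3 by (simp add: Q_def)
qed

text \<open>The triangle \<open>t1 \<le> t2\<close> includes the diagonal, which is where the limit is taken. The bounds \<open>\<delta> \<le> t2 \<le> T\<close>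
  make the set compact and, for \<open>\<delta> > 0\<close>, keep the denominators of the product away from \<open>0\<close>.\<close>

definition q_domain :: "real \<Rightarrow> real \<Rightarrow> real \<Rightarrow> (real \<times> real \<times> real \<times> real) set" where
  "q_domain q \<delta> T = {(t1, t2, y1, y2). 0 \<le> t1 \<and> t1 \<le> t2 \<and> \<delta> \<le> t2 \<and> t2 \<le> T
     \<and> (1 - q) * y1\<^sup>2 \<le> 4 * t1 \<and> (1 - q) * y2\<^sup>2 \<le> 4 * t2}"

lemma compact_q_domain:
  assumes "q < 1"
  shows "compact (q_domain q \<delta> T)"
proof -
  define R where "R = sqrt (4 * T / (1 - q))"
  have R: "\<bar>y\<bar> \<le> R" if "(1 - q) * y\<^sup>2 \<le> 4 * t" "t \<le> T" for y t
  proof -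
    have "y\<^sup>2 \<le> 4 * T / (1 - q)" using that assms by (simp add: field_simps)
    then have "sqrt (y\<^sup>2) \<le> R" unfolding R_def by (rule real_sqrt_le_mono)
    then show ?thesis by simp
  qed
  have sub: "q_domain q \<delta> T \<subseteq> {0..T} \<times> {0..T} \<times> {-R..R} \<times> {-R..R}"
    using R by (fastforce simp: q_domain_def abs_le_iff)
  have "compact ({0..T} \<times> {0..T} \<times> {-R..R} \<times> {-R..R})"
    by (intro compact_Times compact_Icc)
  moreover have "closed (q_domain q \<delta> T)"
    unfolding q_domain_def case_prod_beta
    by (intro closed_Collect_conj closed_Collect_le continuous_intros)
  ultimately have "compact (({0..T} \<times> {0..T} \<times> {-R..R} \<times> {-R..R}) \<inter> q_domain q \<delta> T)"
    by (intro compact_Int_closed)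
  then show ?thesis using sub by (simp add: Int_absorb1)
qed

definition q_product :: "real \<Rightarrow> real \<Rightarrow> real \<Rightarrow> real \<Rightarrow> real \<Rightarrow> real" where
  "q_product q t1 t2 y1 y2 =
     prodinf (\<lambda>k. psi_star q (Suc k) t1 t2 y2 / phi_star q (Suc k) t1 t2 y1 y2)"

lemma phi_star_Suc_ge:
  assumes q: "-1 < q" "q < 1" and t: "0 \<le> t1" "t1 \<le> t2"
    and y: "(1 - q) * y1\<^sup>2 \<le> 4 * t1" "(1 - q) * y2\<^sup>2 \<le> 4 * t2"
  shows "t2\<^sup>2 * (1 - \<bar>q\<bar>) ^ 4 \<le> phi_star q (Suc k) t1 t2 y1 y2"
proof -
  have "t2\<^sup>2 * (1 - \<bar>q\<bar>) ^ 4 = (sqrt t2 * (1 - \<bar>q\<bar>)) ^ 4"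
    using t by (simp add: power_mult_distrib power4_eq_xxxx power2_eq_square)
  also have "\<dots> \<le> (sqrt t2 - sqrt t1 * \<bar>q\<bar> ^ Suc k) ^ 4"
  proof (rule power_mono)
    have "sqrt t1 * \<bar>q\<bar> ^ Suc k \<le> sqrt t2 * \<bar>q\<bar>"
      using t q power_le_one[of "\<bar>q\<bar>" k]
      by (intro mult_mono) (auto intro!: mult_left_le)
    then show "sqrt t2 * (1 - \<bar>q\<bar>) \<le> sqrt t2 - sqrt t1 * \<bar>q\<bar> ^ Suc k"
      by (simp add: algebra_simps)
  qed (use t q in auto)
  also have "\<dots> \<le> phi_star q (Suc k) t1 t2 y1 y2" by (rule phi_star_ge[OF assms])
  finally show ?thesis .
qed

text \<open>Both \<open>psi_star\<close> and \<open>phi_star\<close> are polynomials in \<open>Q = q ^ k\<close> with the same constant term \<open>t2\<^sup>2\<close>. The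
  difference is therefore \<open>Q\<close> times a polynomial, which is bounded by compactness. This
  is what makes the infinite product converge geometrically.\<close>

lemma factor_diff_bound:
  assumes q: "-1 < q" "q < 1"
  obtains C where "0 \<le> C" "\<And>k t1 t2 y1 y2. (t1, t2, y1, y2) \<in> q_domain q \<delta> T \<Longrightarrow>
    \<bar>psi_star q k t1 t2 y2 - phi_star q k t1 t2 y1 y2\<bar> \<le> C * \<bar>q\<bar> ^ k"
proof -
  \<comment> \<open>\<open>psi_star\<close> is \<open>(t2 + Q a) (t2 + Q b)\<close> and \<open>phi_star\<close> is \<open>t2\<^sup>2 + Q c\<close>, so the difference is \<open>Q g\<close>\<close>
  define a where "a = (\<lambda>(Q::real, t1, t2, y1::real, y2::real). - (q * t2 + t1) + q * t1 * Q)"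
  define b where "b = (\<lambda>(Q, t1::real, t2, y1::real, y2). 2 * t2 + t2 * Q - (1 - q) * y2\<^sup>2)"
  define c where "c = (\<lambda>(Q, t1, t2, y1, y2). - 2 * t1 * t2 * Q + t1\<^sup>2 * Q ^ 3
     - (1 - q) * (t2 + t1 * Q\<^sup>2) * y1 * y2 + (1 - q) * (t1 * y2\<^sup>2 + t2 * y1\<^sup>2) * Q)"
  define g where "g = (\<lambda>z. fst (snd (snd z)) * (a z + b z) + fst z * a z * b z - c z)"
  have "compact (({-1..1} :: real set) \<times> q_domain q \<delta> T)"
    by (intro compact_Times compact_q_domain q compact_Icc)
  moreover have "continuous_on UNIV g"
    unfolding g_def a_def b_def c_def case_prod_beta by (intro continuous_intros)
  then have "continuous_on (({-1..1} :: real set) \<times> q_domain q \<delta> T) g"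
    by (rule continuous_on_subset) auto
  ultimately have "bounded (g ` (({-1..1} :: real set) \<times> q_domain q \<delta> T))"
    by (intro compact_imp_bounded compact_continuous_image)
  then obtain C where C: "\<And>z. z \<in> {-1..1} \<times> q_domain q \<delta> T \<Longrightarrow> \<bar>g z\<bar> \<le> C"
    by (auto simp: bounded_iff)
  show ?thesis
  proof (rule that[of "\<bar>C\<bar>"])
    fix k t1 t2 y1 y2 assume mem: "(t1, t2, y1, y2) \<in> q_domain q \<delta> T"
    define Q where "Q = q ^ k"
    have Q: "\<bar>Q\<bar> \<le> 1" "\<bar>Q\<bar> = \<bar>q\<bar> ^ k" "q ^ (k + 1) = q * Q" "q ^ (2 * k) = Q\<^sup>2" "q ^ k = Q"
      using q by (auto simp: Q_def power_abs power_le_one power_even_eq)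
    have "psi_star q k t1 t2 y2 - phi_star q k t1 t2 y1 y2 = Q * g (Q, t1, t2, y1, y2)"
      unfolding psi_star_def phi_star_def Q(3,4,5) g_def a_def b_def c_def
      by (simp add: power2_eq_square power3_eq_cube algebra_simps)
    then have "\<bar>psi_star q k t1 t2 y2 - phi_star q k t1 t2 y1 y2\<bar> = \<bar>q\<bar> ^ k * \<bar>g (Q, t1, t2, y1, y2)\<bar>"
      by (simp add: abs_mult Q(2))
    also have "\<dots> \<le> \<bar>q\<bar> ^ k * \<bar>C\<bar>"
      using C[of "(Q, t1, t2, y1, y2)"] mem Q(1) by (intro mult_left_mono order_trans[OF _ abs_ge_self]) (auto simp: abs_le_iff)
    finally show "\<bar>psi_star q k t1 t2 y2 - phi_star q k t1 t2 y1 y2\<bar> \<le> \<bar>C\<bar> * \<bar>q\<bar> ^ k"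
      by (simp add: mult.commute)
  qed simp
qed

lemma q_product_continuous_pos:
  assumes q: "-1 < q" "q < 1" and \<delta>: "0 < \<delta>"
  shows "continuous_on (q_domain q \<delta> T) (\<lambda>(t1, t2, y1, y2). q_product q t1 t2 y1 y2)"
    and "(t1, t2, y1, y2) \<in> q_domain q \<delta> T \<Longrightarrow> 0 < q_product q t1 t2 y1 y2"
proof -
  let ?f = "\<lambda>k. \<lambda>(t1, t2, y1, y2). psi_star q (Suc k) t1 t2 y2 / phi_star q (Suc k) t1 t2 y1 y2"
  obtain C where C: "0 \<le> C" "\<And>k t1 t2 y1 y2. (t1, t2, y1, y2) \<in> q_domain q \<delta> T \<Longrightarrow>
      \<bar>psi_star q k t1 t2 y2 - phi_star q k t1 t2 y1 y2\<bar> \<le> C * \<bar>q\<bar> ^ k"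
    using factor_diff_bound[OF q] by metis
  define d where "d = \<delta>\<^sup>2 * (1 - \<bar>q\<bar>) ^ 4"
  have d: "0 < d" using q \<delta> by (simp add: d_def)
  have phi: "d \<le> phi_star q (Suc k) t1 t2 y1 y2" if "(t1, t2, y1, y2) \<in> q_domain q \<delta> T" for k t1 t2 y1 y2
  proof -
    have "d \<le> t2\<^sup>2 * (1 - \<bar>q\<bar>) ^ 4"
      using that \<delta> unfolding d_def q_domain_def by (intro mult_right_mono power_mono) auto
    also have "\<dots> \<le> phi_star q (Suc k) t1 t2 y1 y2"
      using that by (intro phi_star_Suc_ge q) (auto simp: q_domain_def)
    finally show ?thesis .
  qed
  have cont: "continuous_on (q_domain q \<delta> T) (?f k)" for k
    unfolding psi_star_def case_prod_beta
  proof (intro continuous_intros ballI)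
    show "continuous_on (q_domain q \<delta> T) (\<lambda>p. phi_star q (Suc k) (fst p) (fst (snd p)) (fst (snd (snd p))) (snd (snd (snd p))))"
      unfolding phi_star_def by (intro continuous_intros)
    show "phi_star q (Suc k) (fst p) (fst (snd p)) (fst (snd (snd p))) (snd (snd (snd p))) \<noteq> 0"
      if "p \<in> q_domain q \<delta> T" for p
      using phi[of "fst p" "fst (snd p)" "fst (snd (snd p))" "snd (snd (snd p))" k] d that by force
  qed
  have pos: "?f k p > 0" if "p \<in> q_domain q \<delta> T" for k p
  proof -
    obtain t1 t2 y1 y2 where p: "p = (t1, t2, y1, y2)" by (metis surj_pair)
    show ?thesis using that phi[of t1 t2 y1 y2 k] d \<delta> unfolding p
      by (auto simp: q_domain_def intro!: divide_pos_pos psi_star_Suc_pos q)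
  qed
  have bound: "\<bar>?f k p - 1\<bar> \<le> C / d * \<bar>q\<bar> ^ Suc k" if "p \<in> q_domain q \<delta> T" for k p
  proof -
    obtain t1 t2 y1 y2 where p: "p = (t1, t2, y1, y2)" by (metis surj_pair)
    have mem: "(t1, t2, y1, y2) \<in> q_domain q \<delta> T" using that p by simp
    note ph = phi[OF mem, of k]
    have "?f k p - 1 = (psi_star q (Suc k) t1 t2 y2 - phi_star q (Suc k) t1 t2 y1 y2) / phi_star q (Suc k) t1 t2 y1 y2"
      using ph d by (simp add: p diff_divide_distrib)
    then have "\<bar>?f k p - 1\<bar> = \<bar>psi_star q (Suc k) t1 t2 y2 - phi_star q (Suc k) t1 t2 y1 y2\<bar> / phi_star q (Suc k) t1 t2 y1 y2"
      using ph d by (simp add: abs_divide)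
    also have "\<dots> \<le> (C * \<bar>q\<bar> ^ Suc k) / d"
      using C(2)[OF mem, of "Suc k"] ph d C(1) by (intro frac_le) auto
    finally show ?thesis by simp
  qed
  have summ: "summable (\<lambda>k. C / d * \<bar>q\<bar> ^ Suc k)"
    using q by (intro summable_mult summable_Suc_iff[THEN iffD2] summable_geometric) auto
  note * = continuous_on_prodinf_real[of "q_domain q \<delta> T" ?f, OF cont pos bound summ]
  show "continuous_on (q_domain q \<delta> T) (\<lambda>(t1, t2, y1, y2). q_product q t1 t2 y1 y2)"
    using *(1) by (simp add: q_product_def case_prod_beta)
  show "(t1, t2, y1, y2) \<in> q_domain q \<delta> T \<Longrightarrow> 0 < q_product q t1 t2 y1 y2"
    using *(2)[of "(t1, t2, y1, y2)"] by (simp add: q_product_def)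
qed

section \<open>The scaling limit of the transition density\<close>

lemma q_kernel_altdef:
  "q_kernel q t1 t2 y1 y2 = ((1 - q) powr (3 / 2) * (t2 - t1)) / (2 * pi)
     * (sqrt (4 * t2 - (1 - q) * y2\<^sup>2) / phi_star q 0 t1 t2 y1 y2) * q_product q t1 t2 y1 y2"
  by (simp add: q_kernel_def q_product_def)

lemma phi_star_0_pos:
  assumes q: "-1 < q" "q < 1" and t: "0 \<le> t1" "t1 < t2"
    and y: "(1 - q) * y1\<^sup>2 \<le> 4 * t1" "(1 - q) * y2\<^sup>2 \<le> 4 * t2"
  shows "0 < phi_star q 0 t1 t2 y1 y2"
proof -
  have "0 < (sqrt t2 - sqrt t1) ^ 4" using t by simp
  also have "\<dots> \<le> phi_star q 0 t1 t2 y1 y2" using phi_star_ge[OF q t(1) _ y, of 0] t by simp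
  finally show ?thesis .
qed

lemma q_kernel_nonneg:
  assumes q: "-1 < q" "q < 1" and t: "0 \<le> t1" "t1 < t2"
    and y: "y1 \<in> q_support q t1" "y2 \<in> q_support q t2"
  shows "0 \<le> q_kernel q t1 t2 y1 y2"
proof -
  have y': "(1 - q) * y1\<^sup>2 \<le> 4 * t1" "(1 - q) * y2\<^sup>2 \<le> 4 * t2"
    using y q by (simp_all add: mem_q_support_iff)
  have "0 < q_product q t1 t2 y1 y2"
    using t y' by (intro q_product_continuous_pos(2)[OF q, of t2 _ _ _ _ t2]) (auto simp: q_domain_def)
  then show ?thesis
    unfolding q_kernel_altdef using t y' phi_star_0_pos[OF q t y'] by simp
qed

lemma q_kernel_measurable:
  assumes q: "-1 < q" "q < 1" and t: "0 \<le> t1" "t1 < t2"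
  shows "(\<lambda>(y1, y2). indicator (q_support q t1) y1 * indicator (q_support q t2) y2
      * q_kernel q t1 t2 y1 y2) \<in> borel_measurable borel"
proof -
  let ?K = "q_support q t1 \<times> q_support q t2"
  have dom: "(t1, t2, fst p, snd p) \<in> q_domain q t2 t2" if "p \<in> ?K" for p
    using that t q by (auto simp: mem_q_support_iff q_domain_def)
  have "continuous_on ?K (\<lambda>p. (\<lambda>(t1, t2, y1, y2). q_product q t1 t2 y1 y2) (t1, t2, fst p, snd p))"
    by (rule continuous_on_compose2[OF q_product_continuous_pos(1)[OF q, of t2 t2]])
       (use t dom in \<open>auto intro!: continuous_intros\<close>)
  then have "continuous_on ?K (\<lambda>p. q_kernel q t1 t2 (fst p) (snd p))"
    unfolding q_kernel_altdef
  proof (intro continuous_intros, goal_cases)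
    case 1 show ?case unfolding phi_star_def by (intro continuous_intros)
  next
    case 2 show ?case
    proof
      fix p assume "p \<in> ?K"
      then show "phi_star q 0 t1 t2 (fst p) (snd p) \<noteq> 0"
        using phi_star_0_pos[OF q t, of "fst p" "snd p"] q by (auto simp: mem_q_support_iff)
    qed
  qed (auto simp: case_prod_beta)
  moreover have "?K \<in> sets borel"
    by (intro borel_closed closed_Times) (auto simp: q_support_def)
  ultimately have "(\<lambda>p. indicator ?K p *\<^sub>R q_kernel q t1 t2 (fst p) (snd p)) \<in> borel_measurable borel"
    by (intro borel_measurable_continuous_on_indicator)
  then show ?thesis by (simp add: indicator_times case_prod_beta)
qed

text \<open>For \<open>t1 = t2\<close> and \<open>y1 = y2\<close> the last factor of \<open>psi_star\<close> also divides \<open>phi_star\<close>, and what is left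
  of the quotient is \<open>(1 - q * Q) / (1 - Q)\<close> with \<open>Q = q ^ Suc k\<close>: the product telescopes.\<close>

lemma q_product_diagonal:
  assumes q: "-1 < q" "q < 1" and s: "0 < s" and x: "(1 - q) * x\<^sup>2 < 4 * s"
  shows "q_product q s s x x = 1 / (1 - q)"
proof -
  have ne: "1 - q ^ Suc k \<noteq> 0" for k
  proof -
    have "\<bar>q ^ Suc k\<bar> < 1"
      using q by (auto simp: power_abs simp del: power_Suc intro!: power_less_one_iff[THEN iffD2])
    then show ?thesis by (simp add: abs_less_iff)
  qed
  have fac: "psi_star q (Suc k) s s x / phi_star q (Suc k) s s x x = (1 - q ^ Suc (Suc k)) / (1 - q ^ Suc k)" for k
  proof -
    define Q where "Q = q ^ Suc k"
    have Q: "q ^ (Suc k + 1) = q * Q" "q ^ (2 * Suc k) = Q\<^sup>2" "q ^ Suc k = Q" "q ^ Suc (Suc k) = q * Q"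
    proof -
      show "q ^ (2 * Suc k) = Q\<^sup>2" unfolding Q_def by (rule power_even_eq)
    qed (simp_all add: Q_def)
    define B where "B = s * (1 + Q)\<^sup>2 - (1 - q) * x\<^sup>2 * Q"
    have phi: "phi_star q (Suc k) s s x x = s * (1 - Q)\<^sup>2 * B"
      unfolding phi_star_def Q B_def by (simp add: power2_eq_square algebra_simps)
    have psi: "psi_star q (Suc k) s s x = s * (1 - Q) * (1 - q * Q) * B"
      unfolding psi_star_def Q B_def by (simp add: algebra_simps)
    have "0 < s\<^sup>2 * (1 - \<bar>q\<bar>) ^ 4" using s q by simp
    also have "\<dots> \<le> phi_star q (Suc k) s s x x"
      using phi_star_Suc_ge[OF q, of s s x x k] s x by simp
    finally have "0 < phi_star q (Suc k) s s x x" .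
    then have "B \<noteq> 0" unfolding phi by auto
    moreover have "1 - Q \<noteq> 0" using ne[of k] by (simp add: Q_def)
    ultimately show ?thesis unfolding phi psi Q using s by (simp add: power2_eq_square)
  qed
  have prod: "(\<Prod>k\<le>n. (1 - q ^ Suc (Suc k)) / (1 - q ^ Suc k)) = (1 - q ^ Suc (Suc n)) / (1 - q)" for n
  proof (induction n)
    case (Suc n)
    then show ?case using ne[of "Suc n"] by (simp del: power_Suc)
  qed simp
  have "(\<lambda>n. q ^ Suc (Suc n)) \<longlonglongrightarrow> 0"
    using q LIMSEQ_abs_realpow_zero2[of q] by (intro LIMSEQ_Suc) auto
  then have "(\<lambda>n. (1 - q ^ Suc (Suc n)) / (1 - q)) \<longlonglongrightarrow> (1 - 0) / (1 - q)"
    using q by (intro tendsto_intros) auto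
  then have "raw_has_prod (\<lambda>k. (1 - q ^ Suc (Suc k)) / (1 - q ^ Suc k)) 0 (1 / (1 - q))"
    using q unfolding raw_has_prod_def by (auto simp: prod simp del: power_Suc)
  then have "(\<lambda>k. (1 - q ^ Suc (Suc k)) / (1 - q ^ Suc k)) has_prod (1 / (1 - q))"
    by (simp add: has_prod_def)
  then show ?thesis unfolding q_product_def fac by (rule has_prod_unique[symmetric])
qed

text \<open>Since \<open>x\<close> is interior, every fixed rescaled point ends up in the support; the restriction of
  the densities to the supports disappears in the limit.\<close>

lemma eventually_mem_q_support:
  assumes "q < 1" and x: "(1 - q) * x\<^sup>2 < 4 * s"
  shows "\<forall>\<^sub>F \<epsilon> in at_right 0. x + \<epsilon> * y \<in> q_support q (s + u * \<epsilon>)"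
proof -
  have "((\<lambda>\<epsilon>. 4 * (s + u * \<epsilon>) - (1 - q) * (x + \<epsilon> * y)\<^sup>2) \<longlongrightarrow>
      4 * (s + u * 0) - (1 - q) * (x + 0 * y)\<^sup>2) (at_right 0)"
    by (intro tendsto_intros)
  from order_tendstoD(1)[OF this, of 0]
  have "\<forall>\<^sub>F \<epsilon> in at_right 0. 0 < 4 * (s + u * \<epsilon>) - (1 - q) * (x + \<epsilon> * y)\<^sup>2"
    using x by simp
  then show ?thesis by eventually_elim (simp add: mem_q_support_iff[OF assms(1)])
qed

text \<open>The local limit behind the theorem. The drift \<open>d\<close> and the scale \<open>c\<close> arise from completing the square in
  the limit of \<open>phi_star q 0 / \<epsilon>\<^sup>2\<close>. The factor \<open>\<epsilon>\<close> on the left is the Jacobian of the substitution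
  \<open>y2 = x + \<epsilon> z\<close>; likewise \<open>1 / c\<close> on the right.\<close>

lemma q_kernel_rescaled_tendsto:
  assumes q: "-1 < q" "q < 1" and s: "0 < s" and x: "(1 - q) * x\<^sup>2 < 4 * s" and uv: "0 \<le> u" "u < v"
  defines "c \<equiv> tangent_scale q s x" and "d \<equiv> x / (2 * s)"
  shows "((\<lambda>\<epsilon>. \<epsilon> * q_kernel q (s + u * \<epsilon>) (s + v * \<epsilon>) (x + \<epsilon> * y) (x + \<epsilon> * z)) \<longlongrightarrow>
     1 / c * cauchy_kernel u v ((y - d * u) / c) ((z - d * v) / c)) (at_right 0)"
proof -
  let ?D = "\<lambda>\<epsilon>. (v - u)\<^sup>2 + (1 - q) * (z - y) * (s * (z - y) - x * (v - u) + \<epsilon> * (u * z - v * y))"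
  have phi: "phi_star q 0 (s + u * \<epsilon>) (s + v * \<epsilon>) (x + \<epsilon> * y) (x + \<epsilon> * z) = \<epsilon>\<^sup>2 * ?D \<epsilon>" for \<epsilon>
    unfolding phi_star_def by (simp add: power2_eq_square algebra_simps)
  have root: "0 < 4 * s / (1 - q) - x\<^sup>2" using x q by (simp add: field_simps)
  have c: "0 < c" "c\<^sup>2 = (4 * s / (1 - q) - x\<^sup>2) / (4 * s\<^sup>2)"
    using root s by (auto simp: c_def tangent_scale_def power_mult_distrib power_divide)
  define e where "e = z - y - d * (v - u)"
  \<comment> \<open>the completed square: \<open>e\<close> is the increment freed from its drift\<close>
  have D0: "?D 0 = (1 - q) * s * (e\<^sup>2 + c\<^sup>2 * (v - u)\<^sup>2)"
    using q s unfolding c(2) d_def e_def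
    by (simp add: power2_eq_square divide_simps) (simp add: algebra_simps)
  have ec: "0 < e\<^sup>2 + c\<^sup>2 * (v - u)\<^sup>2"
    using c(1) uv by (intro add_nonneg_pos mult_pos_pos) auto
  have D0pos: "0 < ?D 0" unfolding D0 using q s ec by simp
  have ev: "\<forall>\<^sub>F \<epsilon> in at_right 0. (s + u * \<epsilon>, s + v * \<epsilon>, x + \<epsilon> * y, x + \<epsilon> * z) \<in> q_domain q s (s + v)"
  proof -
    have "\<forall>\<^sub>F \<epsilon> in at_right (0::real). \<epsilon> < 1" "\<forall>\<^sub>F \<epsilon> in at_right (0::real). 0 < \<epsilon>"
      by (auto simp: eventually_at_right_less intro: order_tendstoD tendsto_ident_at)
    with eventually_mem_q_support[OF q(2) x, of y u] eventually_mem_q_support[OF q(2) x, of z v]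
    show ?thesis
    proof eventually_elim
      case (elim \<epsilon>)
      then show ?case using q uv s mult_right_mono[of u v \<epsilon>] mult_left_le[of \<epsilon> v]
        by (auto simp: q_domain_def mem_q_support_iff)
    qed
  qed
  have "((\<lambda>\<epsilon>. (\<lambda>(t1, t2, y1, y2). q_product q t1 t2 y1 y2)
        (s + u * \<epsilon>, s + v * \<epsilon>, x + \<epsilon> * y, x + \<epsilon> * z)) \<longlongrightarrow>
      (\<lambda>(t1, t2, y1, y2). q_product q t1 t2 y1 y2) (s, s, x, x)) (at_right 0)"
  proof (rule continuous_on_tendsto_compose[OF q_product_continuous_pos(1)[OF q s] _ _ ev])
    have "((\<lambda>\<epsilon>. (s + u * \<epsilon>, s + v * \<epsilon>, x + \<epsilon> * y, x + \<epsilon> * z)) \<longlongrightarrow> (s + u * 0, s + v * 0, x + 0 * y, x + 0 * z)) (at_right 0)"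
      by (intro tendsto_intros)
    then show "((\<lambda>\<epsilon>. (s + u * \<epsilon>, s + v * \<epsilon>, x + \<epsilon> * y, x + \<epsilon> * z)) \<longlongrightarrow> (s, s, x, x)) (at_right 0)" by simp
    show "(s, s, x, x) \<in> q_domain q s (s + v)" using s x uv by (auto simp: q_domain_def)
  qed
  then have prod: "((\<lambda>\<epsilon>. q_product q (s + u * \<epsilon>) (s + v * \<epsilon>) (x + \<epsilon> * y) (x + \<epsilon> * z)) \<longlongrightarrow> 1 / (1 - q)) (at_right 0)"
    using q_product_diagonal[OF q s x] by simp
  have "((\<lambda>\<epsilon>. ((1 - q) powr (3 / 2) * (v - u)) / (2 * pi)
       * (sqrt (4 * (s + v * \<epsilon>) - (1 - q) * (x + \<epsilon> * z)\<^sup>2) / ?D \<epsilon>)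
       * q_product q (s + u * \<epsilon>) (s + v * \<epsilon>) (x + \<epsilon> * y) (x + \<epsilon> * z)) \<longlongrightarrow>
     ((1 - q) powr (3 / 2) * (v - u)) / (2 * pi)
       * (sqrt (4 * (s + v * 0) - (1 - q) * (x + 0 * z)\<^sup>2) / ?D 0) * (1 / (1 - q))) (at_right 0)"
    using D0pos by (intro tendsto_intros prod) auto
  also have "((1 - q) powr (3 / 2) * (v - u)) / (2 * pi)
       * (sqrt (4 * (s + v * 0) - (1 - q) * (x + 0 * z)\<^sup>2) / ?D 0) * (1 / (1 - q))
     = 1 / c * cauchy_kernel u v ((y - d * u) / c) ((z - d * v) / c)"
  proof -
    have pw: "(1 - q) powr (3/2) = (1 - q) * sqrt (1 - q)"
      using q powr_add[of "1 - q" 1 "1/2"] by (simp add: powr_half_sqrt)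
    have "4 * (s + v * 0) - (1 - q) * (x + 0 * z)\<^sup>2 = (1 - q) * (4 * s / (1 - q) - x\<^sup>2)"
      using q by (simp add: field_simps)
    then have sq: "sqrt (4 * (s + v * 0) - (1 - q) * (x + 0 * z)\<^sup>2) = sqrt (1 - q) * (2 * s * c)"
      using s by (simp add: real_sqrt_mult c_def tangent_scale_def)
    have "cauchy_kernel u v ((y - d * u) / c) ((z - d * v) / c)
        = 1 / pi * ((v - u) / ((e / c)\<^sup>2 + (v - u)\<^sup>2))"
    proof -
      have "(z - d * v) / c - (y - d * u) / c = e / c"
        by (simp add: e_def diff_divide_distrib[symmetric] algebra_simps)
      then show ?thesis by (simp add: cauchy_kernel_def)
    qed
    also have "(e / c)\<^sup>2 + (v - u)\<^sup>2 = (e\<^sup>2 + c\<^sup>2 * (v - u)\<^sup>2) / c\<^sup>2"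
      using c(1) by (simp add: field_simps power_divide)
    finally have ck: "1 / c * cauchy_kernel u v ((y - d * u) / c) ((z - d * v) / c)
        = c * (v - u) / (pi * (e\<^sup>2 + c\<^sup>2 * (v - u)\<^sup>2))"
      using c(1) ec by (simp add: power2_eq_square)
    have s2: "sqrt (1 - q) * sqrt (1 - q) = 1 - q" using q by simp
    define E where "E = e\<^sup>2 + c\<^sup>2 * (v - u)\<^sup>2"
    have "((1 - q) powr (3 / 2) * (v - u)) / (2 * pi)
       * (sqrt (4 * (s + v * 0) - (1 - q) * (x + 0 * z)\<^sup>2) / ?D 0) * (1 / (1 - q))
      = ((1 - q) * (sqrt (1 - q) * sqrt (1 - q)) * (v - u) * (2 * s * c)) / (2 * pi * ((1 - q) * s * E) * (1 - q))"
      unfolding D0 sq pw E_def[symmetric] times_divide_times_eq times_divide_eq_right times_divide_eq_left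
        divide_divide_eq_left mult_1_right
      by (simp only: ac_simps)
    also have "\<dots> = c * (v - u) / (pi * E)"
      unfolding s2 using q s by simp
    finally show ?thesis unfolding ck E_def .
  qed
  finally have lim: "((\<lambda>\<epsilon>. ((1 - q) powr (3 / 2) * (v - u)) / (2 * pi)
       * (sqrt (4 * (s + v * \<epsilon>) - (1 - q) * (x + \<epsilon> * z)\<^sup>2) / ?D \<epsilon>)
       * q_product q (s + u * \<epsilon>) (s + v * \<epsilon>) (x + \<epsilon> * y) (x + \<epsilon> * z)) \<longlongrightarrow>
     1 / c * cauchy_kernel u v ((y - d * u) / c) ((z - d * v) / c)) (at_right 0)" .
  show ?thesis
  proof (rule Lim_transform_eventually[OF lim])
    show "\<forall>\<^sub>F \<epsilon> in at_right 0. ((1 - q) powr (3 / 2) * (v - u)) / (2 * pi)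
       * (sqrt (4 * (s + v * \<epsilon>) - (1 - q) * (x + \<epsilon> * z)\<^sup>2) / ?D \<epsilon>)
       * q_product q (s + u * \<epsilon>) (s + v * \<epsilon>) (x + \<epsilon> * y) (x + \<epsilon> * z)
       = \<epsilon> * q_kernel q (s + u * \<epsilon>) (s + v * \<epsilon>) (x + \<epsilon> * y) (x + \<epsilon> * z)"
      using eventually_at_right_less[of 0]
    proof eventually_elim
      case (elim \<epsilon>)
      have "v * \<epsilon> - u * \<epsilon> = \<epsilon> * (v - u)" by (simp add: algebra_simps)
      then show ?case unfolding q_kernel_altdef phi using elim
        by (simp add: power2_eq_square)
    qed
  qed
qed

section \<open>Joint densities of a Markov process\<close>

text \<open>Coordinate \<open>i\<close> of a path is the value after step \<open>i\<close>. The deterministic value \<open>c\<close> before step \<open>0\<close> is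
  not a coordinate, so the state before step \<open>i\<close> is \<open>case i of 0 \<Rightarrow> c | Suc j \<Rightarrow> y j\<close>.\<close>

abbreviation path_space :: "nat \<Rightarrow> (nat \<Rightarrow> real) measure" where
  "path_space m \<equiv> PiM {..<m} (\<lambda>_. lborel)"

lemma measurable_path_prev:
  assumes "i \<le> m"
  shows "(\<lambda>y. case i of 0 \<Rightarrow> c | Suc j \<Rightarrow> y j) \<in> borel_measurable (path_space m)"
proof (cases i)
  case (Suc j)
  then have "j \<in> {..<m}" using assms by simp
  then have "(\<lambda>y. y j) \<in> measurable (path_space m) lborel" by (rule measurable_component_singleton)
  then show ?thesis using Suc by simp
qed simp

lemma borel_measurable_vec:
  fixes h :: "'n::finite \<Rightarrow> 'c \<Rightarrow> real"
  assumes "\<And>i. h i \<in> borel_measurable N"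
  shows "(\<lambda>\<omega>. \<chi> i. h i \<omega>) \<in> borel_measurable N"
  using assms by (subst borel_measurable_euclidean_space) (auto simp: Basis_vec_def inner_axis)

text \<open>The regularity of the transition densities that the joint density needs. Their normalisation is a
  consequence of the Markov property.\<close>

locale markov_densities =
  fixes s x :: real and S :: "real \<Rightarrow> real set" and p :: "real \<Rightarrow> real \<Rightarrow> real \<Rightarrow> real \<Rightarrow> real"
    and M :: "'a measure" and X :: "real \<Rightarrow> 'a \<Rightarrow> real"
  assumes markov: "markov_process_from s x S p M X"
    and start: "x \<in> S s"
    and S_borel: "s \<le> t \<Longrightarrow> S t \<in> sets borel"
    and p_measurable: "s \<le> t1 \<Longrightarrow> t1 < t2 \<Longrightarrow>
      (\<lambda>(y1, y2). indicator (S t1) y1 * indicator (S t2) y2 * p t1 t2 y1 y2) \<in> borel_measurable borel"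
    and p_nonneg: "s \<le> t1 \<Longrightarrow> t1 < t2 \<Longrightarrow> y1 \<in> S t1 \<Longrightarrow> y2 \<in> S t2 \<Longrightarrow> 0 \<le> p t1 t2 y1 y2"
begin

sublocale prob_space M
  using markov by (simp add: markov_process_from_def)

lemma X_measurable: "s \<le> t \<Longrightarrow> X t \<in> borel_measurable M"
  and X_start: "AE \<omega> in M. X s \<omega> = x"
  and cond_exp_X: "s \<le> t1 \<Longrightarrow> t1 < t2 \<Longrightarrow> A \<in> sets borel \<Longrightarrow> AE \<omega> in M.
        real_cond_exp M (natural_filtration M s X t1) (\<lambda>\<omega>'. indicator A (X t2 \<omega>')) \<omega>
          = (LINT y:A \<inter> S t2|lborel. p t1 t2 (X t1 \<omega>) y)"
  using markov unfolding markov_process_from_def by blast+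

text \<open>Extension by \<open>0\<close> off the supports makes the density nonnegative and jointly measurable on the whole
  plane.\<close>

definition extended_kernel :: "real \<Rightarrow> real \<Rightarrow> real \<Rightarrow> real \<Rightarrow> real" where
  "extended_kernel t1 t2 y1 y2 = indicator (S t1) y1 * indicator (S t2) y2 * p t1 t2 y1 y2"

lemma extended_kernel_nonneg: "s \<le> t1 \<Longrightarrow> t1 < t2 \<Longrightarrow> 0 \<le> extended_kernel t1 t2 y1 y2"
  using p_nonneg by (auto simp: extended_kernel_def indicator_def)

lemma extended_kernel_measurable:
  assumes "s \<le> t1" "t1 < t2"
  shows "case_prod (extended_kernel t1 t2) \<in> borel_measurable (borel \<Otimes>\<^sub>M borel)"
  using p_measurable[OF assms] by (simp add: extended_kernel_def[abs_def] borel_prod)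

lemma extended_kernel_measurable_compose:
  assumes "s \<le> t1" "t1 < t2" "f \<in> borel_measurable N" "g \<in> borel_measurable N"
  shows "(\<lambda>\<omega>. extended_kernel t1 t2 (f \<omega>) (g \<omega>)) \<in> borel_measurable N"
  using measurable_compose[OF measurable_Pair[OF assms(3,4)] extended_kernel_measurable[OF assms(1,2)]] by simp

lemma space_natural_filtration [simp]: "space (natural_filtration M s X t) = space M"
  by (simp add: natural_filtration_def space_measure_of_conv)

lemma sets_natural_filtration:
  "sets (natural_filtration M s X t) =
    sigma_sets (space M) (\<Union>u\<in>{s..t}. {X u -` A \<inter> space M | A. A \<in> sets borel})"
  unfolding natural_filtration_def by (rule sets_measure_of) auto

lemma X_measurable_natural_filtration:
  assumes "s \<le> u" "u \<le> t"
  shows "X u \<in> borel_measurable (natural_filtration M s X t)"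
proof (rule measurableI)
  fix A :: "real set" assume "A \<in> sets borel"
  then have "X u -` A \<inter> space M \<in> (\<Union>u\<in>{s..t}. {X u -` A \<inter> space M | A. A \<in> sets borel})"
    using assms \<open>A \<in> sets borel\<close> by (intro UN_I[of u] CollectI exI[of _ A] conjI) auto
  then show "X u -` A \<inter> space (natural_filtration M s X t) \<in> sets (natural_filtration M s X t)"
    unfolding sets_natural_filtration space_natural_filtration by (rule sigma_sets.Basic)
qed simp

lemma finite_measure_subalgebra_natural_filtration:
  "finite_measure_subalgebra M (natural_filtration M s X t)"
proof
  have "sets (natural_filtration M s X t) \<subseteq> sets M"
    unfolding sets_natural_filtration
    by (intro sets.sigma_sets_subset) (auto intro: measurable_sets[OF X_measurable])
  then show "subalgebra M (natural_filtration M s X t)" by (simp add: subalgebra_def)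
qed

text \<open>The target set \<open>- S t\<close> has conditional probability \<open>0\<close>, because the density is integrated over the empty
  set.\<close>

lemma X_in_support:
  assumes "s \<le> t" shows "AE \<omega> in M. X t \<omega> \<in> S t"
proof (cases "t = s")
  case True
  then show ?thesis using X_start start by auto
next
  case False
  with assms have t: "s < t" by simp
  interpret F: finite_measure_subalgebra M "natural_filtration M s X s"
    by (rule finite_measure_subalgebra_natural_filtration)
  note [measurable] = X_measurable[OF assms] S_borel[OF assms]
  let ?f = "\<lambda>\<omega>. indicator (- S t) (X t \<omega>) :: real"
  have int: "integrable M ?f"
    by (rule integrable_const_bound[of _ 1]) auto
  have "AE \<omega> in M. real_cond_exp M (natural_filtration M s X s) ?f \<omega> = 0"
    using cond_exp_X[of s t "- S t"] t by (simp add: set_lebesgue_integral_def)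
  then have "(\<integral>\<omega>. real_cond_exp M (natural_filtration M s X s) ?f \<omega> \<partial>M) = (\<integral>\<omega>. 0 \<partial>M)"
    by (intro integral_cong_AE) auto
  then have "(\<integral>\<omega>. ?f \<omega> \<partial>M) = 0" using F.real_cond_exp_int(2)[OF int] by simp
  then have "AE \<omega> in M. ?f \<omega> = 0"
    using integral_nonneg_eq_0_iff_AE[OF int] by simp
  then show ?thesis by eventually_elim (auto simp: indicator_def split: if_splits)
qed

text \<open>A Bochner integral of a function that is not integrable is \<open>0\<close> by convention, so its value alone does
  not determine the nonnegative integral. The target set \<open>UNIV\<close> settles this: there the conditional
  probability is \<open>1\<close>, hence the density is integrable almost surely.\<close>

lemma cond_exp_X_nn:
  assumes t: "s \<le> t1" "t1 < t2" and A: "A \<in> sets borel"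
  shows "AE \<omega> in M. ennreal (real_cond_exp M (natural_filtration M s X t1) (\<lambda>\<omega>'. indicator A (X t2 \<omega>')) \<omega>)
          = (\<integral>\<^sup>+z. indicator A z * ennreal (extended_kernel t1 t2 (X t1 \<omega>) z) \<partial>lborel)"
proof -
  interpret F: finite_measure_subalgebra M "natural_filtration M s X t1"
    by (rule finite_measure_subalgebra_natural_filtration)
  have "AE \<omega> in M. real_cond_exp M (natural_filtration M s X t1) (\<lambda>_. 1) \<omega> = 1"
    by (intro F.real_cond_exp_F_meas) auto
  moreover have "AE \<omega> in M. real_cond_exp M (natural_filtration M s X t1) (\<lambda>_. 1) \<omega>
        = (LINT y:UNIV \<inter> S t2|lborel. p t1 t2 (X t1 \<omega>) y)"
    using cond_exp_X[OF t, of UNIV] by simp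
  ultimately show ?thesis
    using cond_exp_X[OF t A] X_in_support[OF t(1)]
  proof eventually_elim
    case (elim \<omega>)
    let ?k = "\<lambda>z. extended_kernel t1 t2 (X t1 \<omega>) z"
    have k: "?k z = indicator (S t2) z *\<^sub>R p t1 t2 (X t1 \<omega>) z" for z
      using elim(4) by (simp add: extended_kernel_def)
    have "(\<integral>z. ?k z \<partial>lborel) = 1"
      using elim(1,2) by (simp add: set_lebesgue_integral_def k)
    then have int: "integrable lborel ?k"
      by (metis not_integrable_integral_eq zero_neq_one)
    have int': "integrable lborel (\<lambda>z. indicator A z * ?k z)"
      using integrable_mult_indicator[OF _ int, of A] A by simp
    have "(LINT y:A \<inter> S t2|lborel. p t1 t2 (X t1 \<omega>) y) = (\<integral>z. indicator A z * ?k z \<partial>lborel)"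
      unfolding set_lebesgue_integral_def k by (intro Bochner_Integration.integral_cong) (auto simp: indicator_def)
    then have "ennreal (LINT y:A \<inter> S t2|lborel. p t1 t2 (X t1 \<omega>) y) = (\<integral>\<^sup>+z. ennreal (indicator A z * ?k z) \<partial>lborel)"
      using nn_integral_eq_integral[OF int'] extended_kernel_nonneg[OF t] by simp
    also have "\<dots> = (\<integral>\<^sup>+z. indicator A z * ennreal (?k z) \<partial>lborel)"
      by (intro nn_integral_cong) (auto simp: indicator_def)
    finally show ?case using elim(3) by simp
  qed
qed

lemma transition_nn:
  assumes t: "s \<le> t1" "t1 < t2" and A: "A \<in> sets borel"
    and B: "B \<in> sets (natural_filtration M s X t1)"
  shows "emeasure M {\<omega> \<in> B. X t2 \<omega> \<in> A}
      = (\<integral>\<^sup>+\<omega>. indicator B \<omega> * (\<integral>\<^sup>+z. indicator A z * ennreal (extended_kernel t1 t2 (X t1 \<omega>) z) \<partial>lborel) \<partial>M)"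
proof -
  let ?F = "natural_filtration M s X t1"
  interpret F: finite_measure_subalgebra M ?F
    by (rule finite_measure_subalgebra_natural_filtration)
  have BM: "B \<in> sets M" using B F.subalg by (auto simp: subalgebra_def)
  have [measurable]: "X t2 \<in> borel_measurable M" using X_measurable t by simp
  note [measurable] = A BM
  let ?f = "\<lambda>\<omega>. indicator A (X t2 \<omega>) :: real"
  let ?c = "real_cond_exp M ?F ?f"
  have int: "integrable M ?f" by (rule integrable_const_bound[of _ 1]) auto
  have set: "{\<omega> \<in> B. X t2 \<omega> \<in> A} = {\<omega> \<in> space M. \<omega> \<in> B \<and> X t2 \<omega> \<in> A}"
    using sets.sets_into_space[OF BM] by auto
  have "emeasure M {\<omega> \<in> B. X t2 \<omega> \<in> A} = (\<integral>\<^sup>+\<omega>. indicator {\<omega> \<in> space M. \<omega> \<in> B \<and> X t2 \<omega> \<in> A} \<omega> \<partial>M)"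
    unfolding set by (subst nn_integral_indicator) auto
  also have "\<dots> = (\<integral>\<^sup>+\<omega>. ennreal (indicator B \<omega> *\<^sub>R ?f \<omega>) \<partial>M)"
    by (intro nn_integral_cong) (auto simp: indicator_def)
  also have "\<dots> = ennreal (\<integral>\<omega>\<in>B. ?f \<omega> \<partial>M)"
    unfolding set_lebesgue_integral_def
    by (intro nn_integral_eq_integral integrable_mult_indicator[OF BM int]) auto
  also have "(\<integral>\<omega>\<in>B. ?f \<omega> \<partial>M) = (\<integral>\<omega>\<in>B. ?c \<omega> \<partial>M)"
    by (rule F.real_cond_exp_intA[OF int B])
  also have "ennreal \<dots> = (\<integral>\<^sup>+\<omega>. ennreal (indicator B \<omega> *\<^sub>R ?c \<omega>) \<partial>M)"
    unfolding set_lebesgue_integral_def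
  proof (rule nn_integral_eq_integral[symmetric])
    show "integrable M (\<lambda>\<omega>. indicator B \<omega> *\<^sub>R ?c \<omega>)"
      by (intro integrable_mult_indicator BM F.real_cond_exp_int(1) int)
    have "AE \<omega> in M. 0 \<le> ?c \<omega>" by (rule F.real_cond_exp_pos) auto
    then show "AE \<omega> in M. 0 \<le> indicator B \<omega> *\<^sub>R ?c \<omega>" by eventually_elim auto
  qed
  also have "\<dots> = (\<integral>\<^sup>+\<omega>. indicator B \<omega> * (\<integral>\<^sup>+z. indicator A z * ennreal (extended_kernel t1 t2 (X t1 \<omega>) z) \<partial>lborel) \<partial>M)"
  proof (intro nn_integral_cong_AE)
    show "AE \<omega> in M. ennreal (indicator B \<omega> *\<^sub>R ?c \<omega>) =
        indicator B \<omega> * (\<integral>\<^sup>+z. indicator A z * ennreal (extended_kernel t1 t2 (X t1 \<omega>) z) \<partial>lborel)"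
      using cond_exp_X_nn[OF t A] by eventually_elim (auto simp: indicator_def)
  qed
  finally show ?thesis .
qed

text \<open>The transition density in affine coordinates \<open>(X (\<tau> i) - a i) / b\<close>; the leading \<open>b\<close> is the Jacobian.
  The shift may depend on time, so that a drift can be included.\<close>

definition step_density :: "(nat \<Rightarrow> real) \<Rightarrow> (nat \<Rightarrow> real) \<Rightarrow> real \<Rightarrow> nat \<Rightarrow> real \<Rightarrow> real \<Rightarrow> real" where
  "step_density \<tau> a b i y z = b * extended_kernel (\<tau> i) (\<tau> (Suc i)) (a i + b * y) (a (Suc i) + b * z)"

definition joint_density :: "(nat \<Rightarrow> real) \<Rightarrow> (nat \<Rightarrow> real) \<Rightarrow> real \<Rightarrow> nat \<Rightarrow> (nat \<Rightarrow> real) \<Rightarrow> real" where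
  "joint_density \<tau> a b m y =
     (\<Prod>i<m. step_density \<tau> a b i ((case i of 0 \<Rightarrow> (x - a 0) / b | Suc j \<Rightarrow> y j)) (y i))"

context
  fixes \<tau> a :: "nat \<Rightarrow> real" and b :: real
  assumes b: "b > 0" and \<tau>0: "\<tau> 0 = s"
begin

abbreviation "Y i \<omega> \<equiv> (X (\<tau> i) \<omega> - a i) / b"

lemma times_ge:
  assumes "\<forall>i<m. \<tau> i < \<tau> (Suc i)" and "i \<le> m" shows "s \<le> \<tau> i"
  using assms
proof (induction i)
  case (Suc i)
  then have "s \<le> \<tau> i" "\<tau> i < \<tau> (Suc i)" by auto
  then show ?case by simp
qed (simp add: \<tau>0)

lemma times_mono:
  assumes "\<forall>i<m. \<tau> i < \<tau> (Suc i)" and "i \<le> j" "j \<le> m" shows "\<tau> i \<le> \<tau> j"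
  using assms(2,3)
proof (induction j rule: dec_induct)
  case (step n)
  then have "\<tau> i \<le> \<tau> n" "\<tau> n < \<tau> (Suc n)" using assms(1) by auto
  then show ?case by simp
qed simp

lemma joint_density_nonneg:
  assumes inc: "\<forall>i<m. \<tau> i < \<tau> (Suc i)"
  shows "0 \<le> joint_density \<tau> a b m y"
  unfolding joint_density_def step_density_def using b times_ge[OF inc] inc
  by (intro prod_nonneg mult_nonneg_nonneg ballI extended_kernel_nonneg) auto

lemma step_density_measurable:
  assumes "s \<le> \<tau> i" "\<tau> i < \<tau> (Suc i)" and [measurable]: "f \<in> borel_measurable N" "g \<in> borel_measurable N"
  shows "(\<lambda>\<omega>. step_density \<tau> a b i (f \<omega>) (g \<omega>)) \<in> borel_measurable N"
  unfolding step_density_def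
  by (intro borel_measurable_times borel_measurable_const extended_kernel_measurable_compose assms(1,2)) measurable

lemma joint_density_measurable:
  assumes inc: "\<forall>i<m. \<tau> i < \<tau> (Suc i)"
  shows "joint_density \<tau> a b m \<in> borel_measurable (path_space m)"
  unfolding joint_density_def[abs_def]
proof (intro borel_measurable_prod step_density_measurable measurable_path_prev)
  fix i assume i: "i \<in> {..<m}"
  have "(\<lambda>y. y i) \<in> measurable (path_space m) lborel" by (rule measurable_component_singleton[OF i])
  then show "(\<lambda>y. y i) \<in> borel_measurable (path_space m)" by simp
qed (use times_ge[OF inc] inc in auto)

lemma joint_density_Suc:
  "joint_density \<tau> a b (Suc m) (y(m := z)) = joint_density \<tau> a b m y
     * step_density \<tau> a b m (case m of 0 \<Rightarrow> (x - a 0) / b | Suc j \<Rightarrow> y j) z"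
proof -
  have "(\<Prod>i<m. step_density \<tau> a b i (case i of 0 \<Rightarrow> (x - a 0) / b | Suc j \<Rightarrow> (y(m := z)) j) ((y(m := z)) i))
      = (\<Prod>i<m. step_density \<tau> a b i (case i of 0 \<Rightarrow> (x - a 0) / b | Suc j \<Rightarrow> y j) (y i))"
    by (intro prod.cong refl) (auto split: nat.split)
  then show ?thesis unfolding joint_density_def by (simp split: nat.split)
qed

lemma path_measurable:
  assumes inc: "\<forall>i<m. \<tau> i < \<tau> (Suc i)"
  shows "(\<lambda>\<omega>. \<lambda>i\<in>{..<m}. Y (Suc i) \<omega>) \<in> measurable M (path_space m)"
proof (rule measurable_restrict)
  fix i assume "i \<in> {..<m}"
  then have [measurable]: "X (\<tau> (Suc i)) \<in> borel_measurable M" using times_ge[OF inc] by (intro X_measurable) auto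
  show "Y (Suc i) \<in> measurable M lborel" by simp
qed

text \<open>It suffices to compare boxes. In the induction step the Markov property integrates out the last
  coordinate; what remains is a function of the earlier ones, to which the induction hypothesis applies
  as an equality of measures.\<close>

lemma distr_eq_joint_density:
  assumes inc: "\<forall>i<m. \<tau> i < \<tau> (Suc i)"
  shows "distr M (path_space m) (\<lambda>\<omega>. \<lambda>i\<in>{..<m}. Y (Suc i) \<omega>) = density (path_space m) (\<lambda>y. ennreal (joint_density \<tau> a b m y))"
  using inc
proof (induction m)
  case 0
  show ?case
    by (intro measure_eqI)
       (auto simp: joint_density_def density_1 PiM_empty emeasure_distr restrict_def
         emeasure_space_1 dest!: subset_singletonD)
next
  case (Suc m)
  interpret product_sigma_finite "\<lambda>_::nat. lborel :: real measure" ..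
  have inc: "\<forall>i<m. \<tau> i < \<tau> (Suc i)" using Suc.prems by simp
  note IH = Suc.IH[OF inc]
  have tm: "s \<le> \<tau> m" "\<tau> m < \<tau> (Suc m)" using Suc.prems times_ge[OF Suc.prems, of m] by auto
  let ?prev = "\<lambda>y. case m of 0 \<Rightarrow> (x - a 0) / b | Suc j \<Rightarrow> y j"
  let ?path = "\<lambda>m \<omega>. \<lambda>i\<in>{..<m}. Y (Suc i) \<omega>"
  note path_meas = path_measurable[OF inc] and path_meas' = path_measurable[OF Suc.prems]
  show ?case
  proof (rule measure_eqI_PiM_finite[where A="\<lambda>_. space (path_space (Suc m))"])
    fix A :: "nat \<Rightarrow> real set" assume "\<And>i. i \<in> {..<Suc m} \<Longrightarrow> A i \<in> sets lborel"
    then have A: "A i \<in> sets borel" if "i \<le> m" for i using that by simp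
    have A'[measurable]: "A m \<in> sets borel" using A by simp
    have box: "Pi\<^sub>E {..<m} A \<in> sets (path_space m)" "Pi\<^sub>E {..<Suc m} A \<in> sets (path_space (Suc m))"
      using A by (auto intro!: sets_PiM_I_finite)
    note [measurable] = box(1)
    define B where "B = ?path m -` Pi\<^sub>E {..<m} A \<inter> space M"
    have Bmem: "\<omega> \<in> B \<longleftrightarrow> \<omega> \<in> space M \<and> (\<forall>i<m. Y (Suc i) \<omega> \<in> A i)" for \<omega>
      by (auto simp: B_def PiE_iff)
    have B: "B \<in> sets (natural_filtration M s X (\<tau> m))"
    proof -
      have "?path m \<in> measurable (natural_filtration M s X (\<tau> m)) (path_space m)"
      proof (rule measurable_restrict)
        fix i assume "i \<in> {..<m}"
        then have [measurable]: "X (\<tau> (Suc i)) \<in> borel_measurable (natural_filtration M s X (\<tau> m))"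
          using times_ge[OF inc] times_mono[OF inc] by (intro X_measurable_natural_filtration) auto
        show "Y (Suc i) \<in> measurable (natural_filtration M s X (\<tau> m)) lborel" by simp
      qed
      from measurable_sets[OF this box(1)] show ?thesis by (simp add: B_def)
    qed
    define A1 where "A1 = {z. (z - a (Suc m)) / b \<in> A m}"
    have A1: "A1 \<in> sets borel"
    proof -
      have "(\<lambda>z. (z - a (Suc m)) / b) -` A m \<inter> space borel \<in> sets borel"
        by (rule measurable_sets[OF _ A']) simp
      then show ?thesis by (simp add: A1_def vimage_def)
    qed
    \<comment> \<open>the probability that the path stays in the box, given all coordinates but the last\<close>
    define G where "G y = indicator (Pi\<^sub>E {..<m} A) y *
        (\<integral>\<^sup>+z. indicator (A m) z * ennreal (step_density \<tau> a b m (?prev y) z) \<partial>lborel)" for y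
    have sm[measurable]: "(\<lambda>(y, z). step_density \<tau> a b m (?prev y) z) \<in> borel_measurable (path_space m \<Otimes>\<^sub>M lborel)"
      unfolding case_prod_beta using measurable_path_prev[of m m "(x - a 0) / b"]
      by (intro step_density_measurable tm) (auto intro: measurable_compose[OF measurable_fst])
    have G: "G \<in> borel_measurable (path_space m)" unfolding G_def by measurable
    have "emeasure (distr M (path_space (Suc m)) (?path (Suc m))) (Pi\<^sub>E {..<Suc m} A)
        = emeasure M {\<omega> \<in> B. X (\<tau> (Suc m)) \<omega> \<in> A1}"
    proof (subst emeasure_distr[OF path_meas' box(2)], rule arg_cong[where f="emeasure M"], rule set_eqI)
      fix \<omega>
      have "\<omega> \<in> ?path (Suc m) -` Pi\<^sub>E {..<Suc m} A \<inter> space M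
          \<longleftrightarrow> \<omega> \<in> space M \<and> (\<forall>i<Suc m. Y (Suc i) \<omega> \<in> A i)"
        by (auto simp: PiE_iff)
      also have "\<dots> \<longleftrightarrow> \<omega> \<in> {\<omega> \<in> B. X (\<tau> (Suc m)) \<omega> \<in> A1}"
        by (simp add: Bmem A1_def All_less_Suc conj_ac)
      finally show "\<omega> \<in> ?path (Suc m) -` Pi\<^sub>E {..<Suc m} A \<inter> space M
          \<longleftrightarrow> \<omega> \<in> {\<omega> \<in> B. X (\<tau> (Suc m)) \<omega> \<in> A1}" .
    qed
    also have "\<dots> = (\<integral>\<^sup>+\<omega>. indicator B \<omega> *
        (\<integral>\<^sup>+z. indicator A1 z * ennreal (extended_kernel (\<tau> m) (\<tau> (Suc m)) (X (\<tau> m) \<omega>) z) \<partial>lborel) \<partial>M)"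
      by (rule transition_nn[OF tm A1 B])
    also have "\<dots> = (\<integral>\<^sup>+\<omega>. G (?path m \<omega>) \<partial>M)"
    proof (rule nn_integral_cong_AE)
      have "AE \<omega> in M. ?prev (?path m \<omega>) = Y m \<omega>"
        using X_start by eventually_elim (auto simp: \<tau>0 split: nat.split)
      then show "AE \<omega> in M. indicator B \<omega> *
        (\<integral>\<^sup>+z. indicator A1 z * ennreal (extended_kernel (\<tau> m) (\<tau> (Suc m)) (X (\<tau> m) \<omega>) z) \<partial>lborel) = G (?path m \<omega>)"
        using AE_space
      proof eventually_elim
        case (elim \<omega>)
        have [measurable]: "extended_kernel (\<tau> m) (\<tau> (Suc m)) (X (\<tau> m) \<omega>) \<in> borel_measurable borel"
          by (rule extended_kernel_measurable_compose[OF tm]) auto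
        note [measurable] = A1
        have "(\<integral>\<^sup>+z. indicator A1 z * ennreal (extended_kernel (\<tau> m) (\<tau> (Suc m)) (X (\<tau> m) \<omega>) z) \<partial>lborel)
          = ennreal b * (\<integral>\<^sup>+z. indicator A1 (a (Suc m) + b * z)
               * ennreal (extended_kernel (\<tau> m) (\<tau> (Suc m)) (X (\<tau> m) \<omega>) (a (Suc m) + b * z)) \<partial>lborel)"
          using b by (subst nn_integral_real_affine[where c=b and t="a (Suc m)"]) auto
        also have "\<dots> = (\<integral>\<^sup>+z. ennreal b * (indicator A1 (a (Suc m) + b * z)
               * ennreal (extended_kernel (\<tau> m) (\<tau> (Suc m)) (X (\<tau> m) \<omega>) (a (Suc m) + b * z))) \<partial>lborel)"
          by (rule nn_integral_cmult[symmetric]) measurable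
        also have "\<dots> = (\<integral>\<^sup>+z. indicator (A m) z * ennreal (step_density \<tau> a b m (?prev (?path m \<omega>)) z) \<partial>lborel)"
          using b unfolding elim(1) step_density_def
          by (intro nn_integral_cong) (auto simp: A1_def indicator_def ennreal_mult' )
        moreover have "indicator B \<omega> = (indicator (Pi\<^sub>E {..<m} A) (?path m \<omega>) :: ennreal)"
          using elim(2) by (simp add: B_def indicator_def)
        ultimately show ?case unfolding G_def by simp
      qed
    qed
    also have "\<dots> = (\<integral>\<^sup>+y. G y \<partial>distr M (path_space m) (?path m))"
      using G by (subst nn_integral_distr[OF path_meas]) auto
    also have "\<dots> = (\<integral>\<^sup>+y. ennreal (joint_density \<tau> a b m y) * G y \<partial>path_space m)"
      unfolding IH using joint_density_measurable[OF inc] G by (intro nn_integral_density) auto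
    also have "\<dots> = (\<integral>\<^sup>+y. (\<integral>\<^sup>+z. ennreal (joint_density \<tau> a b (Suc m) (y(m := z)))
         * indicator (Pi\<^sub>E {..<Suc m} A) (y(m := z)) \<partial>lborel) \<partial>path_space m)"
    proof (rule nn_integral_cong)
      fix y assume y: "y \<in> space (path_space m)"
      have ind: "indicator (Pi\<^sub>E {..<Suc m} A) (y(m := z)) = (indicator (Pi\<^sub>E {..<m} A) y * indicator (A m) z :: ennreal)" for z
      proof -
        have "y(m := z) \<in> Pi\<^sub>E {..<Suc m} A \<longleftrightarrow> y \<in> Pi\<^sub>E {..<m} A \<and> z \<in> A m"
          using y by (auto simp: PiE_iff space_PiM extensional_def All_less_Suc Ball_def)
        then show ?thesis by (auto simp: indicator_def)
      qed
      have [measurable]: "(\<lambda>z. step_density \<tau> a b m (?prev y) z) \<in> borel_measurable lborel"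
        by (intro step_density_measurable tm) auto
      have "ennreal (joint_density \<tau> a b m y) * G y = (\<integral>\<^sup>+z. ennreal (joint_density \<tau> a b m y) * (indicator (Pi\<^sub>E {..<m} A) y *
          (indicator (A m) z * ennreal (step_density \<tau> a b m (?prev y) z))) \<partial>lborel)"
        unfolding G_def by (simp add: nn_integral_cmult)
      also have "\<dots> = (\<integral>\<^sup>+z. ennreal (joint_density \<tau> a b (Suc m) (y(m := z)))
         * indicator (Pi\<^sub>E {..<Suc m} A) (y(m := z)) \<partial>lborel)"
        unfolding ind joint_density_Suc ennreal_mult'[OF joint_density_nonneg[OF inc]]
        by (intro nn_integral_cong) (simp only: ac_simps)
      finally show "ennreal (joint_density \<tau> a b m y) * G y = \<dots>" .
    qed
    also have "\<dots> = (\<integral>\<^sup>+y. ennreal (joint_density \<tau> a b (Suc m) y) * indicator (Pi\<^sub>E {..<Suc m} A) y \<partial>path_space (Suc m))"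
      unfolding lessThan_Suc
      using joint_density_measurable[OF Suc.prems] box(2)
      by (intro product_nn_integral_insert[symmetric]) (auto simp: lessThan_Suc)
    also have "\<dots> = emeasure (density (path_space (Suc m)) (\<lambda>y. ennreal (joint_density \<tau> a b (Suc m) y))) (Pi\<^sub>E {..<Suc m} A)"
      using joint_density_measurable[OF Suc.prems] box(2) by (intro emeasure_density[symmetric]) auto
    finally show "emeasure (distr M (path_space (Suc m)) (?path (Suc m))) (Pi\<^sub>E {..<Suc m} A) = \<dots>" .
  next
    show "emeasure (distr M (path_space (Suc m)) (?path (Suc m))) (space (path_space (Suc m))) \<noteq> \<infinity>"
      using prob_space.emeasure_space_1[OF prob_space_distr[OF path_meas']] by simp
    show "range (\<lambda>_. space (path_space (Suc m))) \<subseteq> prod_algebra {..<Suc m} (\<lambda>_. lborel)"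
      using space_in_prod_algebra[of "{..<Suc m}" "\<lambda>_. lborel :: real measure"] by (auto simp: space_PiM)
  qed auto
qed

lemma path_integral:
  fixes g :: "(nat \<Rightarrow> real) \<Rightarrow> real"
  assumes inc: "\<forall>i<m. \<tau> i < \<tau> (Suc i)" and g: "g \<in> borel_measurable (path_space m)"
  shows "(\<integral>\<omega>. g (\<lambda>i\<in>{..<m}. Y (Suc i) \<omega>) \<partial>M) = (\<integral>y. joint_density \<tau> a b m y * g y \<partial>path_space m)"
proof -
  have "(\<integral>\<omega>. g (\<lambda>i\<in>{..<m}. Y (Suc i) \<omega>) \<partial>M)
      = (\<integral>y. g y \<partial>distr M (path_space m) (\<lambda>\<omega>. \<lambda>i\<in>{..<m}. Y (Suc i) \<omega>))"
    by (rule integral_distr[OF path_measurable[OF inc] g, symmetric])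
  also have "\<dots> = (\<integral>y. joint_density \<tau> a b m y *\<^sub>R g y \<partial>path_space m)"
    unfolding distr_eq_joint_density[OF inc]
    by (intro integral_density g joint_density_measurable[OF inc] AE_I2 joint_density_nonneg[OF inc])
  finally show ?thesis by simp
qed

lemma joint_density_total:
  assumes inc: "\<forall>i<m. \<tau> i < \<tau> (Suc i)"
  shows "(\<integral>\<^sup>+y. ennreal (joint_density \<tau> a b m y) \<partial>path_space m) = 1"
proof -
  have "(\<integral>\<^sup>+y. ennreal (joint_density \<tau> a b m y) \<partial>path_space m)
      = emeasure (density (path_space m) (\<lambda>y. ennreal (joint_density \<tau> a b m y))) (space (path_space m))"
    using joint_density_measurable[OF inc]
    by (subst emeasure_density) (auto intro!: nn_integral_cong)
  also have "\<dots> = 1"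
    using prob_space.emeasure_space_1[OF prob_space_distr[OF path_measurable[OF inc]]]
    unfolding distr_eq_joint_density[OF inc] by simp
  finally show ?thesis .
qed

text \<open>The index map \<open>j\<close> lets the observation times repeat and occur in any order; \<open>j i = 0\<close> marks the
  initial time, at which the process is \<open>0\<close> because the shift starts at \<open>a 0 = x\<close>.\<close>

lemma integral_fdd:
  fixes f :: "real ^ 'n \<Rightarrow> real" and t :: "real ^ 'n"
  assumes inc: "\<forall>i<m. \<tau> i < \<tau> (Suc i)"
    and a0: "a 0 = x" and j: "\<And>i. j i \<le> m"
    and U_meas: "\<And>i. U (t $ i) \<in> borel_measurable M"
    and U: "AE \<omega> in M. \<forall>i. U (t $ i) \<omega> = Y (j i) \<omega>"
    and f: "continuous_on UNIV f"
  shows "integral\<^sup>L (fdd M U t) f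
      = (\<integral>y. joint_density \<tau> a b m y * f (\<chi> i. case j i of 0 \<Rightarrow> 0 | Suc k \<Rightarrow> y k) \<partial>path_space m)"
proof -
  have fm[measurable]: "f \<in> borel_measurable borel" using f by (rule borel_measurable_continuous_onI)
  let ?\<Phi> = "\<lambda>y::nat \<Rightarrow> real. \<chi> i. case j i of 0 \<Rightarrow> 0 | Suc k \<Rightarrow> y k"
  have \<Phi>: "?\<Phi> \<in> borel_measurable (path_space m)"
    by (intro borel_measurable_vec measurable_path_prev j)
  have f\<Phi>: "(\<lambda>y. f (?\<Phi> y)) \<in> borel_measurable (path_space m)"
    by (rule measurable_compose[OF \<Phi> fm])
  have "integral\<^sup>L (fdd M U t) f = (\<integral>\<omega>. f (\<chi> i. U (t $ i) \<omega>) \<partial>M)"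
    unfolding fdd_def by (intro integral_distr borel_measurable_vec U_meas fm)
  also have "\<dots> = (\<integral>\<omega>. f (?\<Phi> (\<lambda>i\<in>{..<m}. Y (Suc i) \<omega>)) \<partial>M)"
  proof (rule integral_cong_AE)
    show "(\<lambda>\<omega>. f (\<chi> i. U (t $ i) \<omega>)) \<in> borel_measurable M"
      by (intro measurable_compose[OF _ fm] borel_measurable_vec U_meas)
    show "(\<lambda>\<omega>. f (?\<Phi> (\<lambda>i\<in>{..<m}. Y (Suc i) \<omega>))) \<in> borel_measurable M"
      by (rule measurable_compose[OF path_measurable[OF inc] f\<Phi>])
    show "AE \<omega> in M. f (\<chi> i. U (t $ i) \<omega>) = f (?\<Phi> (\<lambda>i\<in>{..<m}. Y (Suc i) \<omega>))"
      using U X_start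
    proof eventually_elim
      case (elim \<omega>)
      have "U (t $ i) \<omega> = (case j i of 0 \<Rightarrow> 0 | Suc k \<Rightarrow> (\<lambda>i\<in>{..<m}. Y (Suc i) \<omega>) k)" for i
        using elim j[of i] by (auto simp: \<tau>0 a0 split: nat.split)
      then show ?case by simp
    qed
  qed
  also have "\<dots> = (\<integral>y. joint_density \<tau> a b m y * f (?\<Phi> y) \<partial>path_space m)"
    by (rule path_integral[OF inc f\<Phi>])
  finally show ?thesis .
qed

end

end

section \<open>Convergence of the finite-dimensional distributions\<close>

lemma Scheffe_bounded_test_function:
  fixes F :: "nat \<Rightarrow> 'a \<Rightarrow> real"
  assumes F: "\<And>n. F n \<in> borel_measurable L" "\<And>n y. 0 \<le> F n y" "\<And>n. (\<integral>\<^sup>+y. ennreal (F n y) \<partial>L) = 1"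
    and f: "f \<in> borel_measurable L" "\<And>y. 0 \<le> f y" "(\<integral>\<^sup>+y. ennreal (f y) \<partial>L) = 1"
    and lim: "\<And>y. y \<in> space L \<Longrightarrow> (\<lambda>n. F n y) \<longlonglongrightarrow> f y"
    and g: "g \<in> borel_measurable L" "\<And>y. \<bar>g y\<bar> \<le> C"
  shows "(\<lambda>n. \<integral>y. F n y * g y \<partial>L) \<longlonglongrightarrow> (\<integral>y. f y * g y \<partial>L)"
proof -
  note [measurable] = F(1) f(1) g(1)
  have intf: "integrable L f" using f by (intro integrableI_nonneg) auto
  have intF: "integrable L (F n)" for n using F by (intro integrableI_nonneg) auto
  have "(\<lambda>n. \<integral>\<^sup>+y. norm (F n y - f y) \<partial>L) \<longlonglongrightarrow> 0"
    by (rule Scheffe_lemma2) (use F f lim intf in auto)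
  moreover have "(\<integral>\<^sup>+y. norm (F n y - f y) \<partial>L) = ennreal (\<integral>y. \<bar>F n y - f y\<bar> \<partial>L)" for n
    using intf intF by (subst nn_integral_eq_integral) auto
  ultimately have "(\<lambda>n. ennreal (\<integral>y. \<bar>F n y - f y\<bar> \<partial>L)) \<longlonglongrightarrow> ennreal 0" by simp
  then have L1: "(\<lambda>n. \<integral>y. \<bar>F n y - f y\<bar> \<partial>L) \<longlonglongrightarrow> 0"
    by (rule tendsto_ennreal_iff[THEN iffD1, rotated 2]) auto
  have prod: "integrable L (\<lambda>y. h y * g y)" if "integrable L h" for h
  proof (rule Bochner_Integration.integrable_bound)
    show "integrable L (\<lambda>y. C * h y)" using that by simp
    show "AE y in L. norm (h y * g y) \<le> norm (C * h y)"
      using g(2) by (auto simp: abs_mult mult.commute intro!: mult_right_mono AE_I2 order_trans[OF g(2)])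
    show "(\<lambda>y. h y * g y) \<in> borel_measurable L" using that by measurable
  qed
  have "norm ((\<integral>y. F n y * g y \<partial>L) - (\<integral>y. f y * g y \<partial>L)) \<le> C * (\<integral>y. \<bar>F n y - f y\<bar> \<partial>L)" for n
  proof -
    have "(\<integral>y. F n y * g y \<partial>L) - (\<integral>y. f y * g y \<partial>L) = (\<integral>y. (F n y - f y) * g y \<partial>L)"
      using prod[OF intF] prod[OF intf] by (simp add: left_diff_distrib)
    also have "norm \<dots> \<le> (\<integral>y. norm ((F n y - f y) * g y) \<partial>L)" by (rule integral_norm_bound)
    also have "\<dots> \<le> (\<integral>y. C * \<bar>F n y - f y\<bar> \<partial>L)"
    proof (rule integral_mono)
      show "integrable L (\<lambda>y. norm ((F n y - f y) * g y))"
        using prod[of "\<lambda>y. F n y - f y"] intF intf by (intro integrable_norm) simp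
      show "norm ((F n y - f y) * g y) \<le> C * \<bar>F n y - f y\<bar>" for y
        using mult_right_mono[OF g(2), of "\<bar>F n y - f y\<bar>" y] by (simp add: abs_mult mult.commute)
    qed (use intF intf in simp)
    finally show ?thesis by simp
  qed
  moreover have "(\<lambda>n. C * (\<integral>y. \<bar>F n y - f y\<bar> \<partial>L)) \<longlonglongrightarrow> 0"
    using tendsto_mult_left[OF L1, of C] by simp
  ultimately show ?thesis
    by (subst Lim_null) (rule Lim_null_comparison[OF always_eventually], auto)
qed

lemma enumerate_times:
  fixes A :: "real set"
  assumes "finite A" "0 \<in> A" "\<And>r. r \<in> A \<Longrightarrow> 0 \<le> r"
  obtains m and \<tau> :: "nat \<Rightarrow> real" where "\<tau> 0 = 0" "\<forall>i<m. \<tau> i < \<tau> (Suc i)" "\<tau> ` {..m} = A"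
proof -
  define xs where "xs = sorted_list_of_set A"
  have xs: "set xs = A" "sorted xs" "distinct xs" "xs \<noteq> []"
    using assms by (auto simp: xs_def)
  have len: "{..length xs - 1} = {..<length xs}" using xs(4) by (cases xs) auto
  show ?thesis
  proof (rule that[of "nth xs" "length xs - 1"])
    obtain k where k: "k < length xs" "xs ! k = 0" using assms(2) xs(1) by (metis in_set_conv_nth)
    have "xs ! 0 \<le> xs ! k" using k xs(2) by (intro sorted_nth_mono) auto
    moreover have "xs ! 0 \<in> A" using xs(1,4) by (metis length_greater_0_conv nth_mem)
    ultimately show "xs ! 0 = 0" using assms(3) k by force
    show "\<forall>i<length xs - 1. xs ! i < xs ! Suc i"
      using xs(2,3) strict_sorted_iff[of xs] by (auto intro!: sorted_wrt_nth_less[of "(<)"])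
    show "(!) xs ` {..length xs - 1} = A"
      unfolding len xs(1)[symmetric] by (auto simp: set_conv_nth)
  qed
qed

theorem proposition2p5:
  fixes q s x :: real
    and M :: "'a measure" and W :: "real \<Rightarrow> 'a \<Rightarrow> real"
    and N :: "'b measure" and Z :: "real \<Rightarrow> 'b \<Rightarrow> real"
    and t :: "real ^ 'n"
  assumes "q \<in> {-1<..<1}"
    and "s > 0"
    and "x \<in> {- 2 * sqrt (s / (1 - q)) <..< 2 * sqrt (s / (1 - q))}"
    and "q_brownian_motion_from q s x M W"
    and "cauchy_process N Z"
    and "\<And>i. t $ i \<ge> 0"
  shows "weakly_converges
           (\<lambda>\<epsilon>. fdd M (rescaled_increments W s \<epsilon>) t)
           (fdd N (\<lambda>r \<omega>. tangent_scale q s x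
                     * (Z r \<omega> + x / sqrt (4 * s / (1 - q) - x\<^sup>2) * r)) t)
           (at_right 0)"
proof -
  have q: "-1 < q" "q < 1" using assms(1) by auto
  note s = assms(2)
  have x: "(1 - q) * x\<^sup>2 < 4 * s"
  proof -
    have "\<bar>x\<bar> < sqrt (4 * s / (1 - q))" using assms(3) by (auto simp: real_sqrt_mult real_sqrt_divide)
    then have "sqrt (x\<^sup>2) < sqrt (4 * s / (1 - q))" by simp
    then have "x\<^sup>2 < 4 * s / (1 - q)" by (simp only: real_sqrt_less_iff)
    then show ?thesis using q by (simp add: field_simps)
  qed
  interpret W: markov_densities s x "q_support q" "q_kernel q" M W
  proof
    show "markov_process_from s x (q_support q) (q_kernel q) M W"
      using assms(4) by (simp add: q_brownian_motion_from_def)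
    show "x \<in> q_support q s" using x q by (simp add: mem_q_support_iff)
    show "q_support q r \<in> sets borel" for r by (simp add: q_support_def)
  qed (use q s in \<open>auto intro!: q_kernel_measurable q_kernel_nonneg\<close>)
  interpret Z: markov_densities 0 0 "\<lambda>_. UNIV" cauchy_kernel N Z
  proof
    show "markov_process_from 0 0 (\<lambda>_. UNIV) cauchy_kernel N Z"
      using assms(5) by (simp add: cauchy_process_def)
    show "(\<lambda>(y1, y2). indicator UNIV y1 * indicator UNIV y2 * cauchy_kernel t1 t2 y1 y2) \<in> borel_measurable borel" for t1 t2
      unfolding borel_prod[symmetric] cauchy_kernel_def by measurable
  qed (auto simp: cauchy_kernel_def)
  define c where "c = tangent_scale q s x"
  define e where "e = x / sqrt (4 * s / (1 - q) - x\<^sup>2)"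
  have root: "0 < 4 * s / (1 - q) - x\<^sup>2" using x q by (simp add: field_simps)
  have c: "0 < c" using root s by (simp add: c_def tangent_scale_def)
  have ce: "x / (2 * s) = c * e" using root by (simp add: c_def tangent_scale_def e_def)

  have "finite (insert 0 (range (\<lambda>i. t $ i)))" by simp
  then obtain m and \<tau> :: "nat \<Rightarrow> real" where \<tau>: "\<tau> 0 = 0" "\<forall>i<m. \<tau> i < \<tau> (Suc i)"
    and im: "\<tau> ` {..m} = insert 0 (range (\<lambda>i. t $ i))"
    by (rule enumerate_times) (use assms(6) in auto)
  have "\<forall>i. \<exists>k\<le>m. t $ i = \<tau> k"
  proof
    fix i
    have "t $ i \<in> \<tau> ` {..m}" unfolding im by simp
    then show "\<exists>k\<le>m. t $ i = \<tau> k" by auto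
  qed
  then obtain j where j: "\<And>i. j i \<le> m" "\<And>i. t $ i = \<tau> (j i)" by metis
  \<comment> \<open>\<open>\<tau>\<close> lists the distinct observation times together with the time \<open>0\<close>\<close>
  have \<tau>_nonneg: "0 \<le> \<tau> i" if "i \<le> m" for i
    using im assms(6) that by (metis atMost_iff image_eqI insertE order_refl rangeE)

  define P where "P = path_space m"
  \<comment> \<open>shift and scale turn the q-Brownian motion into its rescaled increments, and the Cauchy process \<open>Z\<close> into \<open>c * (Z + e * \<tau>)\<close>\<close>
  define F where "F \<epsilon> = W.joint_density (\<lambda>i. s + \<tau> i * \<epsilon>) (\<lambda>_. x) \<epsilon> m" for \<epsilon>
  define H where "H = Z.joint_density \<tau> (\<lambda>i. - (e * \<tau> i)) (1 / c) m"
  have incW: "\<forall>i<m. s + \<tau> i * \<epsilon> < s + \<tau> (Suc i) * \<epsilon>" if "0 < \<epsilon>" for \<epsilon>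
    using \<tau>(2) that by simp

  have conv: "((\<lambda>\<epsilon>. F \<epsilon> y) \<longlongrightarrow> H y) (at_right 0)" for y
    unfolding F_def H_def W.joint_density_def Z.joint_density_def W.step_density_def Z.step_density_def
  proof (intro tendsto_prod)
    fix i assume i: "i \<in> {..<m}"
    define u v y1 y2 where "u = \<tau> i" and "v = \<tau> (Suc i)" and "y1 = (case i of 0 \<Rightarrow> 0 | Suc k \<Rightarrow> y k)" and "y2 = y i"
    have uv: "0 \<le> u" "u < v" using \<tau>(2) \<tau>_nonneg i by (auto simp: u_def v_def)
    have prevW: "(case i of 0 \<Rightarrow> (x - x) / \<epsilon> | Suc k \<Rightarrow> y k) = y1" for \<epsilon>
      by (simp add: y1_def split: nat.split)
    have prevZ: "(case i of 0 \<Rightarrow> (0 - - (e * \<tau> 0)) / (1 / c) | Suc k \<Rightarrow> y k) = y1"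
      by (simp add: y1_def \<tau>(1) split: nat.split)
    have shift: "- (e * r) + 1 / c * z = (z - x / (2 * s) * r) / c" for r z
      unfolding ce using c by (simp add: field_simps)
    have "((\<lambda>\<epsilon>. \<epsilon> * W.extended_kernel (s + u * \<epsilon>) (s + v * \<epsilon>) (x + \<epsilon> * y1) (x + \<epsilon> * y2)) \<longlongrightarrow>
        1 / c * cauchy_kernel u v ((y1 - x / (2 * s) * u) / c) ((y2 - x / (2 * s) * v) / c)) (at_right 0)"
    proof (rule Lim_transform_eventually[OF q_kernel_rescaled_tendsto[OF q s x uv, of y1 y2, folded c_def]])
      show "\<forall>\<^sub>F \<epsilon> in at_right 0. \<epsilon> * q_kernel q (s + u * \<epsilon>) (s + v * \<epsilon>) (x + \<epsilon> * y1) (x + \<epsilon> * y2)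
          = \<epsilon> * W.extended_kernel (s + u * \<epsilon>) (s + v * \<epsilon>) (x + \<epsilon> * y1) (x + \<epsilon> * y2)"
        using eventually_mem_q_support[OF q(2) x, of y1 u] eventually_mem_q_support[OF q(2) x, of y2 v]
        by eventually_elim (simp add: W.extended_kernel_def)
    qed
    then show "((\<lambda>\<epsilon>. \<epsilon> * W.extended_kernel (s + \<tau> i * \<epsilon>) (s + \<tau> (Suc i) * \<epsilon>)
           (x + \<epsilon> * (case i of 0 \<Rightarrow> (x - x) / \<epsilon> | Suc k \<Rightarrow> y k)) (x + \<epsilon> * y i)) \<longlongrightarrow>
        1 / c * Z.extended_kernel (\<tau> i) (\<tau> (Suc i))
           (- (e * \<tau> i) + 1 / c * (case i of 0 \<Rightarrow> (0 - - (e * \<tau> 0)) / (1 / c) | Suc k \<Rightarrow> y k))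
           (- (e * \<tau> (Suc i)) + 1 / c * y i)) (at_right 0)"
      unfolding prevW prevZ shift Z.extended_kernel_def by (simp add: u_def v_def y2_def)
  qed

  show ?thesis
    unfolding weakly_converges_def
  proof (intro allI impI, elim conjE)
    fix f :: "real ^ 'n \<Rightarrow> real"
    assume f: "continuous_on UNIV f" "bounded (range f)"
    obtain C where C: "\<And>v. \<bar>f v\<bar> \<le> C" using f(2) by (auto simp: bounded_iff)
    let ?g = "\<lambda>y. f (\<chi> i. case j i of 0 \<Rightarrow> 0 | Suc k \<Rightarrow> y k)"
    have limit: "integral\<^sup>L (fdd N (\<lambda>r \<omega>. c * (Z r \<omega> + e * r)) t) f = (\<integral>y. H y * ?g y \<partial>P)"
      unfolding H_def P_def
    proof (rule Z.integral_fdd)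
      have "Z (t $ i) \<in> borel_measurable N" for i by (rule Z.X_measurable[OF assms(6)])
      then show "(\<lambda>\<omega>. c * (Z (t $ i) \<omega> + e * t $ i)) \<in> borel_measurable N" for i by simp
      show "AE \<omega> in N. \<forall>i. c * (Z (t $ i) \<omega> + e * t $ i) = (Z (\<tau> (j i)) \<omega> - - (e * \<tau> (j i))) / (1 / c)"
        by (simp add: j(2))
    qed (use c \<tau> j f in auto)
    have pre: "integral\<^sup>L (fdd M (rescaled_increments W s \<epsilon>) t) f = (\<integral>y. F \<epsilon> y * ?g y \<partial>P)" if \<epsilon>: "0 < \<epsilon>" for \<epsilon>
      unfolding F_def P_def
    proof (rule W.integral_fdd)
      have "W (s + t $ i * \<epsilon>) \<in> borel_measurable M" "W s \<in> borel_measurable M" for i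
        using assms(6) \<epsilon> by (auto intro!: W.X_measurable)
      then show "rescaled_increments W s \<epsilon> (t $ i) \<in> borel_measurable M" for i
        unfolding rescaled_increments_def[abs_def] by simp
      show "AE \<omega> in M. \<forall>i. rescaled_increments W s \<epsilon> (t $ i) \<omega> = (W (s + \<tau> (j i) * \<epsilon>) \<omega> - x) / \<epsilon>"
        using W.X_start by eventually_elim (simp add: rescaled_increments_def j(2))
    qed (use \<epsilon> \<tau> incW j f in auto)
    have meas_g: "?g \<in> borel_measurable P"
      unfolding P_def using f(1)
      by (intro measurable_compose[OF borel_measurable_vec borel_measurable_continuous_onI]
          measurable_path_prev j)
    have main: "((\<lambda>\<epsilon>. \<integral>y. F \<epsilon> y * ?g y \<partial>P) \<longlongrightarrow> (\<integral>y. H y * ?g y \<partial>P)) (at_right 0)"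
    proof (rule tendsto_at_right_sequentially[of 0 1])
      fix \<epsilon> :: "nat \<Rightarrow> real" assume \<epsilon>: "\<And>n. 0 < \<epsilon> n" "\<epsilon> \<longlonglongrightarrow> 0"
      have "filterlim \<epsilon> (at_right 0) sequentially"
        unfolding filterlim_at using \<epsilon> by (simp add: less_imp_neq[THEN not_sym])
      then have lim: "(\<lambda>n. F (\<epsilon> n) y) \<longlonglongrightarrow> H y" for y
        by (rule filterlim_compose[OF conv])
      show "(\<lambda>n. \<integral>y. F (\<epsilon> n) y * ?g y \<partial>P) \<longlonglongrightarrow> (\<integral>y. H y * ?g y \<partial>P)"
      proof (rule Scheffe_bounded_test_function[OF _ _ _ _ _ _ lim meas_g C])
        fix n y
        show "F (\<epsilon> n) \<in> borel_measurable P" unfolding F_def P_def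
          by (rule W.joint_density_measurable[OF \<epsilon>(1) _ incW[OF \<epsilon>(1)]]) (simp add: \<tau>)
        show "0 \<le> F (\<epsilon> n) y" unfolding F_def
          by (rule W.joint_density_nonneg[OF \<epsilon>(1) _ incW[OF \<epsilon>(1)]]) (simp add: \<tau>)
        show "(\<integral>\<^sup>+y. ennreal (F (\<epsilon> n) y) \<partial>P) = 1" unfolding F_def P_def
          by (rule W.joint_density_total[OF \<epsilon>(1) _ incW[OF \<epsilon>(1)]]) (simp add: \<tau>)
        show "H \<in> borel_measurable P" unfolding H_def P_def
          by (rule Z.joint_density_measurable[OF _ \<tau>]) (simp add: c)
        show "0 \<le> H y" unfolding H_def
          by (rule Z.joint_density_nonneg[OF _ \<tau>]) (simp add: c)
        show "(\<integral>\<^sup>+y. ennreal (H y) \<partial>P) = 1" unfolding H_def P_def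
          by (rule Z.joint_density_total[OF _ \<tau>]) (simp add: c)
      qed
    qed simp
    show "((\<lambda>\<epsilon>. integral\<^sup>L (fdd M (rescaled_increments W s \<epsilon>) t) f) \<longlongrightarrow>
       integral\<^sup>L (fdd N (\<lambda>r \<omega>. tangent_scale q s x * (Z r \<omega> + x / sqrt (4 * s / (1 - q) - x\<^sup>2) * r)) t) f) (at_right 0)"
      unfolding c_def[symmetric] e_def[symmetric] limit
    proof (rule Lim_transform_eventually[OF main])
      show "\<forall>\<^sub>F \<epsilon> in at_right 0. (\<integral>y. F \<epsilon> y * ?g y \<partial>P) = integral\<^sup>L (fdd M (rescaled_increments W s \<epsilon>) t) f"
        using eventually_at_right_less[of 0] by eventually_elim (simp add: pre)
    qed
  qed
qed

end
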